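(* Let $S$ be an $\varepsilon_S$-secure seed conditioned on quantum side information $E_S$, and let $X_1$ and $X_2$ be $\varepsilon_1$- and $\varepsilon_2$-secure keys conditioned on quantum side information $E_1$ and $E_2$, respectively. Let $S$, $X_1$, $X_2$ each be independent from any other quantum side information, i.e. the joint state is $\rho_{SE_S}\otimes\rho_{X_1E_1}\otimes\rho_{X_2E_2}$. Let $X=X_1\circ X_2$ be the concatenation of $X_1$ and $X_2$, and let $L$ be an entropy budget (the maximum number of classical bits about $X$ that may be revealed to the adversary). Let $\varepsilon'>0$, and let $Z=f_S(X)$ be the output, of length $|output|$ bits, of a randomness extractor based on a $1$-almost universal$_2$ family of hash functions $\{f_s\}$ indexed by the seed. If $$|output|\le|X|-L-2\log\left(\frac{1}{\varepsilon'}\right)+2,$$ then the output is $(\varepsilon_S+\varepsilon_1+\varepsilon_2+\varepsilon')$-secure; that is, with the seed $S$ public, $E_S,E_1,E_2$ held by the adversary, and $E_L$ the classical register holding the leaked information about $X$, $$D_u(Z|S\,E_S\,E_1\,E_2\,E_L)_\rho\le\varepsilon_S+\varepsilon_1+\varepsilon_2+\varepsilon'.$$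
   Context: Logarithms are base 2. All Hilbert spaces are finite-dimensional. $|X|$ denotes the length in bits of a bitstring-valued variable $X$. $S$, $X_1$, $X_2$ are classical (bitstrings), so their joint states with side information are classical-quantum, e.g. $\rho_{XE}=\sum_x|x\rangle\langle x|_X\otimes\rho_E^{[x]}$, where $\mathrm{Tr}\rho_E^{[x]}$ is the probability of $x$. $\mathcal{P}(\mathcal{H})$ is the set of positive semi-definite operators on $\mathcal{H}$; states lie in $S_{\le}(\mathcal{H})=\{\rho\in\mathcal{P}(\mathcal{H}):0<\mathrm{Tr}\rho\le 1\}$. Distance from uniform: $D_u(A|B)_\rho=\min_{\sigma_B\in\mathcal{P}(\mathcal{H}_B):\,\mathrm{Tr}\sigma_B=\mathrm{Tr}\rho_B}\frac12\left\|\rho_{AB}-\frac{\mathbb{I}_A}{\dim\mathcal{H}_A}\otimes\sigma_B\right\|_1$. A variable $A$ is $\varepsilon$-secure ($\varepsilon$-close to uniform random) conditioned on $B$ if $D_u(A|B)_\rho\le\varepsilon$. $1$-almost universal$_2$: for all inputs $x\ne x'$, when $s$ is uniform over all seeds, $\Pr_s[f_s(x)=f_s(x')]\le 2^{-|output|}$. Entropy budget and leakage: leakage of at most $L$ bits about $X$ is modelled by a function $l$ of the value $x$ of $X$, taking values in $L$-bit strings, whose value is stored in a classical register $E_L$ given to the adversary: the state of $X$ and side information $E_X=E_1E_2$ becomes $\sum_x|x\rangle\langle x|_X\otimes\rho_{E_X}^{[x]}\otimes|l(x)\rangle\langle l(x)|_{E_L}$; the security parameters $\varepsilon_1,\varepsilon_2$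 refer to the state before leakage and are not degraded by it. The output state is obtained by computing $z=f_s(x)$ from $s$ and $x$, keeping $s$ and discarding $x$. *)

theory Defs
  imports "HOL-Analysis.Analysis" "HOL-Library.Type_Length"
    "HOL-Probability.Probability_Mass_Function"
begin

section \<open>Bitstrings of fixed length\<close>

text \<open>
  The length is carried by a type of class \<^class>\<open>len0\<close>, so that the length zero
  (no leakage, empty output) is included, unlike with functions from a finite type to
  \<^typ>\<open>bool\<close>.
\<close>

typedef (overloaded) 'n bitstring = "{xs :: bool list. length xs = LENGTH('n::len0)}"
  morphisms list_of_bits bits_of_list
  by (rule exI [of _ "replicate LENGTH('n) False"]) simp

instance bitstring :: (len0) finite
proof
  have "finite {xs :: bool list. length xs = LENGTH('a)}"
    using finite_lists_length_eq [of "UNIV :: bool set" "LENGTH('a)"] by simp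
  moreover have "(UNIV :: 'a bitstring set) =
      bits_of_list ` {xs :: bool list. length xs = LENGTH('a)}"
    using type_definition.Abs_image [OF type_definition_bitstring] by auto
  ultimately show "finite (UNIV :: 'a bitstring set)"
    by (metis finite_imageI)
qed

instantiation sum :: (len0, len0) len0
begin

definition len_sum: "len_of (_ :: ('a + 'b) itself) = LENGTH('a) + LENGTH('b)"

instance ..

end

definition bits_append ::
    "'n::len0 bitstring \<Rightarrow> 'm::len0 bitstring \<Rightarrow> ('n + 'm) bitstring"  (infixr \<open>\<circ>\<^sub>b\<close> 65)
  where "x \<circ>\<^sub>b y = bits_of_list (list_of_bits x @ list_of_bits y)"

section \<open>Operators on finite-dimensional Hilbert spaces\<close>

text \<open>
  A Hilbert space with an orthonormal basis indexed by the finite type \<open>'i\<close> is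
  \<open>complex^'i\<close>, and its operators are given by their matrices \<open>complex^'i^'i\<close>.
  The tensor product of two spaces has its basis indexed by the product type.
\<close>

type_synonym 'i operator = "((complex, 'i) vec, 'i) vec"

definition dagger :: "'i::finite operator \<Rightarrow> 'i operator"
  where "dagger A = map_matrix cnj (transpose A)"

definition psd :: "'i::finite operator \<Rightarrow> bool"
  where "psd A \<longleftrightarrow> (\<forall>v :: complex^'i. (\<Sum>i\<in>UNIV. cnj (v $ i) * (A *v v) $ i) \<in> \<real>\<^sub>\<ge>\<^sub>0)"

definition psd_sqrt :: "'i::finite operator \<Rightarrow> 'i operator"
  where "psd_sqrt A = (THE R. psd R \<and> R ** R = A)"

definition trace_norm :: "'i::finite operator \<Rightarrow> real"
  where "trace_norm A = Re (trace (psd_sqrt (dagger A ** A)))"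

definition tensor :: "'a::finite operator \<Rightarrow> 'b::finite operator \<Rightarrow> ('a \<times> 'b) operator"
    (infixr \<open>\<otimes>\<close> 70)
  where "A \<otimes> B = (\<chi> i j. A $ fst i $ fst j * B $ snd i $ snd j)"

definition partial_trace_fst :: "('a::finite \<times> 'b::finite) operator \<Rightarrow> 'b operator"
  where "partial_trace_fst \<rho> = (\<chi> b b'. \<Sum>a\<in>UNIV. \<rho> $ (a, b) $ (a, b'))"

text \<open>The projector $|x\rangle\langle x|$ onto a basis vector.\<close>

definition proj :: "'x::finite \<Rightarrow> 'x operator"
  where "proj x = (\<chi> i j. if i = x \<and> j = x then 1 else 0)"

definition state :: "'i::finite operator \<Rightarrow> bool"
  where "state \<rho> \<longleftrightarrow> psd \<rho> \<and> 0 < Re (trace \<rho>) \<and> Re (trace \<rho>) \<le> 1"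

definition cq_state :: "('x::finite \<times> 'e::finite) operator \<Rightarrow> bool"
  where "cq_state \<rho> \<longleftrightarrow>
    state \<rho> \<and> (\<exists>r :: 'x \<Rightarrow> 'e operator. \<rho> = (\<Sum>x\<in>UNIV. proj x \<otimes> r x))"

text \<open>
  Distance from uniform of the first subsystem conditioned on the second. The infimum is a
  minimum: the admissible \<open>\<sigma>\<close> form a nonempty compact set, on which the trace distance is
  continuous.
\<close>

definition dist_uniform :: "('a::finite \<times> 'b::finite) operator \<Rightarrow> real"
  where "dist_uniform \<rho> =
    Inf {1 / 2 * trace_norm (\<rho> - mat (1 / of_nat CARD('a)) \<otimes> \<sigma>) | \<sigma> :: 'b operator.
          psd \<sigma> \<and> trace \<sigma> = trace (partial_trace_fst \<rho>)}"

definition secure :: "real \<Rightarrow> ('a::finite \<times> 'b::finite) operator \<Rightarrow> bool"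
  where "secure \<epsilon> \<rho> \<longleftrightarrow> dist_uniform \<rho> \<le> \<epsilon>"

section \<open>Extraction\<close>

definition one_almost_universal2 ::
    "('s::len0 bitstring \<Rightarrow> 'n::len0 bitstring \<Rightarrow> 'z::len0 bitstring) \<Rightarrow> bool"
  where "one_almost_universal2 f \<longleftrightarrow>
    (\<forall>x x'. x \<noteq> x' \<longrightarrow>
      measure_pmf.prob (pmf_of_set UNIV) {s. f s x = f s x'} \<le> 1 / 2 ^ LENGTH('z))"

text \<open>
  The unnormalised state of the three side-information systems when the classical
  registers hold \<open>s\<close>, \<open>x1\<close>, \<open>x2\<close>.
\<close>

definition conditional_state ::
    "(('s::finite \<times> 'es::finite) \<times> ('x1::finite \<times> 'e1::finite) \<times> ('x2::finite \<times> 'e2::finite)) operator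
      \<Rightarrow> 's \<Rightarrow> 'x1 \<Rightarrow> 'x2 \<Rightarrow> ('es \<times> 'e1 \<times> 'e2) operator"
  where "conditional_state \<omega> s x1 x2 =
    (\<chi> i j. case i of (a, b, c) \<Rightarrow> case j of (a', b', c') \<Rightarrow>
       \<omega> $ ((s, a), (x1, b), (x2, c)) $ ((s, a'), (x1, b'), (x2, c')))"

text \<open>
  The state obtained from the joint state \<open>\<omega>\<close> of $(S E_S)(X_1 E_1)(X_2 E_2)$ by storing the
  leaked value \<open>l x\<close> in $E_L$, computing \<open>f s x\<close> and discarding \<open>x = x1 \<circ>\<^sub>b x2\<close>. The systems
  are ordered as $Z$, $S$, $E_S E_1 E_2$, $E_L$.
\<close>

definition output_state ::
    "('s::len0 bitstring \<Rightarrow> ('n1::len0 + 'n2::len0) bitstring \<Rightarrow> 'z::len0 bitstring)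
      \<Rightarrow> (('n1 + 'n2) bitstring \<Rightarrow> 'l::len0 bitstring)
      \<Rightarrow> (('s bitstring \<times> 'es::finite) \<times> ('n1 bitstring \<times> 'e1::finite)
            \<times> ('n2 bitstring \<times> 'e2::finite)) operator
      \<Rightarrow> ('z bitstring \<times> 's bitstring \<times> ('es \<times> 'e1 \<times> 'e2) \<times> 'l bitstring) operator"
  where "output_state f l \<omega> =
    (\<Sum>s\<in>UNIV. \<Sum>x1\<in>UNIV. \<Sum>x2\<in>UNIV.
       proj (f s (x1 \<circ>\<^sub>b x2)) \<otimes> proj s \<otimes> conditional_state \<omega> s x1 x2 \<otimes> proj (l (x1 \<circ>\<^sub>b x2)))"

end

theory Submission
  imports Defs
begin

text \<open>
  For positive operators \<open>P\<close>, \<open>Q\<close> the trace norm of \<open>P - Q\<close> is at most \<open>tr P + tr Q\<close>, with equality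
  for the positive and negative parts of the difference. Hence it is subadditive, does not
  increase under positive trace-preserving maps, and in particular under the extraction map.
  Replacing the seed and the two keys one at a time by ideal ones, uniform and in tensor product
  with some $\sigma$, costs \<open>\<epsilon>S + \<epsilon>1 + \<epsilon>2\<close>. Once all three are ideal, the quantum side information
  is in tensor product with the classical registers, so what remains is the classical leftover
  hash lemma for a uniform input with leaked \<open>l x\<close>: by Cauchy-Schwarz and the collision bound, the
  distance is at most \<open>1/2 * sqrt (|Z| |E| / |X|) \<le> \<epsilon>'\<close>.
\<close>

section \<open>Spectral theory and the trace norm\<close>

definition cinner :: "complex^'n::finite \<Rightarrow> complex^'n \<Rightarrow> complex"
  where "cinner v w = (\<Sum>i\<in>UNIV. cnj (v $ i) * w $ i)"

definition hermitian :: "'n::finite operator \<Rightarrow> bool"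
  where "hermitian A \<longleftrightarrow> dagger A = A"

definition diag_matrix :: "('n \<Rightarrow> real) \<Rightarrow> 'n::finite operator"
  where "diag_matrix d = (\<chi> i j. if i = j then of_real (d i) else 0)"

lemma dagger_nth [simp]: "dagger A $ i $ j = cnj (A $ j $ i)"
  by (simp add: dagger_def map_matrix_def transpose_def)

lemma psd_cinner: "psd A \<longleftrightarrow> (\<forall>v. cinner v (A *v v) \<in> \<real>\<^sub>\<ge>\<^sub>0)"
  by (simp add: psd_def cinner_def)

lemma dagger_dagger [simp]: "dagger (dagger A) = A"
  by (simp add: vec_eq_iff)

lemma dagger_diff: "dagger (A - B) = dagger A - dagger B"
  by (simp add: vec_eq_iff)

lemma dagger_mult: "dagger (A ** B) = dagger B ** dagger A"
  by (simp add: vec_eq_iff matrix_matrix_mult_def mult.commute)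

lemma dagger_diag [simp]: "dagger (diag_matrix d) = diag_matrix d"
  by (auto simp add: vec_eq_iff diag_matrix_def)

lemma diag_mult: "diag_matrix d ** diag_matrix e = diag_matrix (\<lambda>i. d i * e i)"
  by (auto simp add: vec_eq_iff diag_matrix_def matrix_matrix_mult_def if_distrib [where f = "\<lambda>x. x * _"]
      cong: if_cong)

lemma hermitian_nth: "hermitian A \<Longrightarrow> cnj (A $ j $ i) = A $ i $ j"
  by (metis dagger_nth hermitian_def)

lemma hermitian_diff: "hermitian A \<Longrightarrow> hermitian B \<Longrightarrow> hermitian (A - B)"
  by (simp add: hermitian_def dagger_diff)

lemma cinner_add_left: "cinner (u + v) w = cinner u w + cinner v w"
  and cinner_add_right: "cinner u (v + w) = cinner u v + cinner u w"
  and cinner_scaleR_left: "cinner (r *\<^sub>R u) w = of_real r * cinner u w"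
  and cinner_scaleR_right: "cinner u (r *\<^sub>R w) = of_real r * cinner u w"
  and cinner_scale_left: "cinner (c *s u) w = cnj c * cinner u w"
  and cinner_scale_right: "cinner u (c *s w) = c * cinner u w"
  by (simp_all add: cinner_def algebra_simps sum.distrib sum_subtractf scaleR_conv_of_real[where 'a = complex]
      sum_distrib_left)

lemma cinner_commute: "cinner v w = cnj (cinner w v)"
  by (simp add: cinner_def mult.commute)

lemma inner_cinner: "v \<bullet> w = Re (cinner v w)"
  by (simp add: cinner_def inner_vec_def inner_complex_def)

lemma cinner_self: "cinner v v = of_real ((norm v)\<^sup>2)"
proof -
  have "cinner v v \<in> \<real>"
    using cinner_commute [of v v] by (simp add: Reals_cnj_iff)
  then show ?thesis
    using inner_cinner [of v v]
    by (metis of_real_Re power2_norm_eq_inner)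
qed

lemma cinner_eq_0_iff [simp]: "cinner v v = 0 \<longleftrightarrow> v = 0"
  by (simp add: cinner_self)

lemma cinner_dagger: "cinner v (A *v w) = cinner (dagger A *v v) w"
proof -
  have "cinner v (A *v w) = (\<Sum>i\<in>UNIV. \<Sum>j\<in>UNIV. cnj (v $ i) * (A $ i $ j * w $ j))"
    by (simp add: cinner_def matrix_vector_mult_def sum_distrib_left)
  also have "\<dots> = (\<Sum>j\<in>UNIV. \<Sum>i\<in>UNIV. cnj (v $ i) * (A $ i $ j * w $ j))"
    by (rule sum.swap)
  also have "\<dots> = cinner (dagger A *v v) w"
    by (simp add: cinner_def matrix_vector_mult_def sum_distrib_left sum_distrib_right mult_ac)
  finally show ?thesis .
qed

lemma cinner_hermitian: "hermitian A \<Longrightarrow> cinner v (A *v w) = cinner (A *v v) w"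
  by (simp add: cinner_dagger hermitian_def)

lemma matrix_vector_mult_scale: "A *v (c *s x) = c *s (A *v (x :: complex^'n::finite))"
  by (simp add: vector_scalar_commute)

lemma matrix_vector_mult_scaleR: "A *v (r *\<^sub>R x) = r *\<^sub>R (A *v (x :: complex^'n::finite))"
  by (simp add: vec_eq_iff matrix_vector_mult_def scaleR_sum_right)

lemma cinner_axis: "cinner (axis i 1) (A *v axis j 1) = A $ i $ j"
proof -
  have "cinner (axis i 1) w = w $ i" for w
    by (simp add: cinner_def axis_def if_distrib [where f = cnj]
        if_distrib [where f = "\<lambda>x. x * _"] cong: if_cong)
  then show ?thesis
    by (simp add: matrix_vector_mult_def axis_def if_distrib [where f = "\<lambda>x. _ * x"] cong: if_cong)
qed

text \<open>Polarization: a quadratic form that takes only real values has a hermitian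
  matrix.\<close>

lemma psd_imp_hermitian:
  assumes "psd A"
  shows "hermitian A"
proof -
  define q where "q v = cinner v (A *v v)" for v
  have q: "Im (q v) = 0" for v
    using assms by (simp add: psd_cinner q_def complex_nonneg_Reals_iff)
  have "cnj (A $ j $ i) = A $ i $ j" for i j
  proof -
    \<comment> \<open>The test vectors \<open>axis i 1 + axis j 1\<close> and
      \<open>axis i 1 + \<i> *s axis j 1\<close> isolate the imaginary and the real part of
      \<open>A $ i $ j - cnj (A $ j $ i)\<close>.\<close>
    have "Im (A $ i $ j + A $ j $ i) = 0"
      using q [of "axis i 1 + axis j 1"] q [of "axis i 1"] q [of "axis j 1"]
      by (simp add: q_def matrix_vector_right_distrib cinner_add_left cinner_add_right cinner_axis)
    moreover have "Im (\<i> * A $ i $ j - \<i> * A $ j $ i) = 0"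
      using q [of "axis i 1 + \<i> *s axis j 1"] q [of "axis i 1"] q [of "axis j 1"]
      by (simp add: q_def matrix_vector_right_distrib cinner_add_left cinner_add_right cinner_axis
          matrix_vector_mult_scale cinner_scale_left cinner_scale_right)
    ultimately show ?thesis
      by (simp add: complex_eq_iff)
  qed
  then show ?thesis
    by (simp add: hermitian_def vec_eq_iff)
qed

lemma psd_sandwich:
  assumes "psd A"
  shows "psd (C ** A ** dagger C)"
proof -
  have "cinner v ((C ** A ** dagger C) *v v) = cinner (dagger C *v v) (A *v (dagger C *v v))" for v
    by (simp add: cinner_dagger [of _ C] flip: matrix_vector_mul_assoc)
  with assms show ?thesis
    by (simp add: psd_cinner)
qed

text \<open>The \<open>c i k\<close> are the entries of a possibly rectangular matrix whose product
  with its adjoint is \<open>A\<close>, so the quadratic form is a sum of squared moduli. The free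
  index type of \<open>k\<close> admits pairs, as tensor products require.\<close>

lemma psd_gram:
  fixes A :: "'n::finite operator" and c :: "'n \<Rightarrow> 'k::finite \<Rightarrow> complex"
  assumes A: "\<And>i j. A $ i $ j = (\<Sum>k\<in>UNIV. c i k * cnj (c j k))"
  shows "psd A"
proof -
  have "cinner v (A *v v) = of_real (\<Sum>k\<in>UNIV. (cmod (\<Sum>i\<in>UNIV. cnj (v $ i) * c i k))\<^sup>2)" for v
  proof -
    have "cinner v (A *v v) = (\<Sum>i\<in>UNIV. \<Sum>j\<in>UNIV. \<Sum>k\<in>UNIV. (cnj (v $ i) * c i k) * (v $ j * cnj (c j k)))"
      by (simp add: cinner_def matrix_vector_mult_def A sum_distrib_left sum_distrib_right mult_ac)
    also have "\<dots> = (\<Sum>i\<in>UNIV. \<Sum>k\<in>UNIV. \<Sum>j\<in>UNIV. (cnj (v $ i) * c i k) * (v $ j * cnj (c j k)))"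
      by (intro sum.cong refl sum.swap)
    also have "\<dots> = (\<Sum>k\<in>UNIV. \<Sum>i\<in>UNIV. \<Sum>j\<in>UNIV. (cnj (v $ i) * c i k) * (v $ j * cnj (c j k)))"
      by (rule sum.swap)
    also have "\<dots> = (\<Sum>k\<in>UNIV. (\<Sum>i\<in>UNIV. cnj (v $ i) * c i k) * cnj (\<Sum>j\<in>UNIV. cnj (v $ j) * c j k))"
      by (simp add: sum_product)
    finally show ?thesis
      unfolding of_real_sum complex_norm_square .
  qed
  then show ?thesis
    by (simp add: psd_cinner sum_nonneg flip: of_real_sum of_real_power)
qed

lemma psd_diag:
  assumes "\<And>i. 0 \<le> d i"
  shows "psd (diag_matrix d)"
proof (rule psd_gram)
  fix i j
  show "diag_matrix d $ i $ j =
      (\<Sum>k\<in>UNIV. (if i = k then of_real (sqrt (d k)) else 0) * cnj (if j = k then of_real (sqrt (d k)) else 0))"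
    using assms
    by (auto simp add: diag_matrix_def if_distrib [where f = cnj] if_distrib [where f = "\<lambda>x. x * _"]
        simp flip: of_real_mult cong: if_cong)
qed

text \<open>Rayleigh quotient: the vectors orthogonal to the known eigenvectors form an
  \<open>A\<close>-invariant space, and a unit vector maximising \<open>w \<bullet> (A *v w)\<close>
  in it is an eigenvector.\<close>

lemma hermitian_eigenvector_exists:
  fixes A :: "'n::finite operator" and v :: "'n \<Rightarrow> complex^'n"
  assumes A: "hermitian A" and S: "card S < CARD('n)"
    and eig: "\<And>j. j \<in> S \<Longrightarrow> A *v v j = d j *\<^sub>R v j"
  obtains w r where "norm w = 1" "A *v w = r *\<^sub>R w" "\<And>j. j \<in> S \<Longrightarrow> cinner (v j) w = 0"
proof -
  \<comment> \<open>\<open>orthogonal\<close> refers to the real inner product; including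
    \<open>\<i> *s v j\<close> turns it into complex orthogonality. The doubled number of vectors
    still stays below the real dimension, which is twice \<open>CARD('n)\<close>.\<close>
  define T where "T = v ` S \<union> (\<lambda>j. \<i> *s v j) ` S"
  define W where "W = {w. \<forall>j\<in>S. cinner (v j) w = 0}"
  have "finite S" by simp
  have "dim T \<le> card T"
    unfolding T_def by (rule dim_le_card') auto
  also have "\<dots> \<le> 2 * card S"
    unfolding T_def using card_Un_le [of "v ` S" "(\<lambda>j. \<i> *s v j) ` S"]
      card_image_le [OF \<open>finite S\<close>, of v] card_image_le [OF \<open>finite S\<close>, of "\<lambda>j. \<i> *s v j"] by linarith
  also have "\<dots> < DIM(complex^'n)"
    using S by simp
  finally obtain w0 where w0: "w0 \<noteq> 0" "\<And>y. y \<in> T \<Longrightarrow> orthogonal w0 y"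
    using orthogonal_to_subspace_exists [of T] by (metis span_base)
  have "cinner (v j) w0 = 0" if "j \<in> S" for j
  proof -
    have "w0 \<bullet> v j = 0" "w0 \<bullet> (\<i> *s v j) = 0"
      using w0(2) that by (auto simp add: T_def orthogonal_def)
    then show ?thesis
      by (subst cinner_commute) (simp add: inner_cinner cinner_scale_right complex_eq_iff)
  qed
  then have "w0 \<in> W"
    by (simp add: W_def)
  have W_scale: "x \<in> W \<Longrightarrow> r *\<^sub>R x \<in> W"
    and W_add: "x \<in> W \<Longrightarrow> y \<in> W \<Longrightarrow> x + y \<in> W"
    and W_A: "x \<in> W \<Longrightarrow> A *v x \<in> W" for r x y
    by (simp_all add: W_def cinner_scaleR_right cinner_add_right cinner_hermitian [OF A] eig
        cinner_scaleR_left)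
  define K where "K = W \<inter> sphere 0 1"
  have cont: "continuous_on X (\<lambda>x. A *v x)" for X
    by (intro linear_continuous_on linear_linear [THEN iffD2] matrix_vector_mul_linear)
  have contq: "continuous_on X (\<lambda>x. x \<bullet> (A *v x))" for X
    by (intro continuous_intros cont)
  have "closed W"
  proof -
    have "W = (\<Inter>j\<in>S. {w. cinner (v j) w = 0})"
      by (auto simp add: W_def)
    moreover have "closed {w. cinner (v j) w = 0}" for j
      unfolding cinner_def by (intro closed_Collect_eq continuous_intros)
    ultimately show ?thesis by auto
  qed
  then have "compact K"
    unfolding K_def by (intro closed_Int_compact) auto
  moreover have "K \<noteq> {}"
  proof -
    have "(1 / norm w0) *\<^sub>R w0 \<in> K"
      using \<open>w0 \<in> W\<close> w0(1) by (simp add: K_def W_scale)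
    then show ?thesis by blast
  qed
  ultimately obtain w where "w \<in> K" and max: "\<And>y. y \<in> K \<Longrightarrow> y \<bullet> (A *v y) \<le> w \<bullet> (A *v w)"
    using continuous_attains_sup [OF _ _ contq] by metis
  then have "w \<in> W" "norm w = 1"
    by (auto simp add: K_def)
  define r where "r = w \<bullet> (A *v w)"
  have max': "y \<bullet> (A *v y) \<le> r * (y \<bullet> y)" if "y \<in> W" for y
  proof (cases "y = 0")
    case False
    have "(1 / norm y) *\<^sub>R y \<in> K"
      using that False by (simp add: K_def W_scale)
    from max [OF this] have "(y \<bullet> (A *v y)) / (norm y)\<^sup>2 \<le> r"
      by (simp add: r_def matrix_vector_mult_scaleR power2_eq_square)
    then show ?thesis
      using False by (simp add: power2_norm_eq_inner field_simps)
  qed simp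
  \<comment> \<open>Up to a factor 2, \<open>h\<close> is the gradient of
    \<open>y \<bullet> (A *v y) - r * (y \<bullet> y)\<close> at \<open>w\<close>. It lies in
    \<open>W\<close>, so the maximiser may be perturbed along it.\<close>
  define h where "h = A *v w - r *\<^sub>R w"
  have "h \<in> W"
    using W_add [OF W_A W_scale, of w w "- r"] \<open>w \<in> W\<close> by (simp add: h_def)
  have wAh: "w \<bullet> (A *v h) = h \<bullet> (A *v w)"
    by (metis inner_cinner cinner_hermitian [OF A] inner_commute)
  have hh: "h \<bullet> (A *v w) - r * (h \<bullet> w) = h \<bullet> h"
    by (simp add: h_def inner_diff_right)
  define c where "c = r * (h \<bullet> h) - h \<bullet> (A *v h)"
  \<comment> \<open>Maximality of \<open>w\<close>, tested at \<open>w + t *\<^sub>R h\<close>: the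
    constant terms cancel, and the first-order gain is bounded by a second-order term.\<close>
  have *: "2 * t * (h \<bullet> h) \<le> t\<^sup>2 * c" for t
  proof -
    have "w + t *\<^sub>R h \<in> W"
      using \<open>w \<in> W\<close> \<open>h \<in> W\<close> by (simp add: W_add W_scale)
    from max' [OF this] have "(w + t *\<^sub>R h) \<bullet> (A *v w + t *\<^sub>R (A *v h)) \<le> r * ((w + t *\<^sub>R h) \<bullet> (w + t *\<^sub>R h))"
      by (simp add: matrix_vector_right_distrib matrix_vector_mult_scaleR)
    then have "2 * t * (h \<bullet> (A *v w) - r * (h \<bullet> w)) \<le> t\<^sup>2 * c + r * (w \<bullet> w) - w \<bullet> (A *v w)"
      by (simp add: inner_add_left inner_add_right wAh c_def inner_commute [of w h] algebra_simps power2_eq_square)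
    moreover have "w \<bullet> w = 1"
      using \<open>norm w = 1\<close> by (simp add: norm_eq_1)
    ultimately show ?thesis
      by (simp only: hh) (simp add: r_def)
  qed
  have "h \<bullet> h \<le> 0"
  proof (rule ccontr)
    assume "\<not> h \<bullet> h \<le> 0"
    then have pos: "h \<bullet> h > 0" by linarith
    \<comment> \<open>Small enough for the first-order gain to win; the \<open>+ 1\<close> keeps the
      denominator positive when \<open>c\<close> is 0.\<close>
    define t where "t = (h \<bullet> h) / (\<bar>c\<bar> + 1)"
    have "t > 0" using pos by (simp add: t_def add_nonneg_pos)
    then have "2 * (h \<bullet> h) \<le> t * c"
      using * [of t] by (simp add: power2_eq_square)
    also have "\<dots> \<le> t * (\<bar>c\<bar> + 1)"
      using \<open>t > 0\<close> by (intro mult_left_mono) auto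
    also have "\<dots> = h \<bullet> h"
      by (simp add: t_def)
    finally show False using pos by simp
  qed
  then have "h = 0"
    by (metis inner_eq_zero_iff inner_ge_zero order_antisym)
  then have "A *v w = r *\<^sub>R w"
    by (simp add: h_def)
  with \<open>norm w = 1\<close> \<open>w \<in> W\<close> that show ?thesis
    by (auto simp add: W_def)
qed

text \<open>The orthonormal family of eigenvectors grows by one index at a time. Since the labels
  are elements of \<open>'n\<close>, the complete family forms the columns of a square
  matrix.\<close>

lemma hermitian_diagonalizable:
  fixes A :: "'n::finite operator"
  assumes A: "hermitian A"
  obtains V d where "dagger V ** V = mat 1" "V ** dagger V = mat 1"
    "A = V ** diag_matrix d ** dagger V"
proof -
  have "\<exists>v d. \<forall>i\<in>S. A *v v i = d i *\<^sub>R v i \<and> (\<forall>j\<in>S. cinner (v i) (v j) = of_bool (i = j))" for S :: "'n set"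
  proof (induction S rule: finite_induct [OF finite])
    case 1
    then show ?case by simp
  next
    case (2 k S)
    then obtain v d where v: "\<And>i. i \<in> S \<Longrightarrow> A *v v i = d i *\<^sub>R v i"
      and on: "\<And>i j. i \<in> S \<Longrightarrow> j \<in> S \<Longrightarrow> cinner (v i) (v j) = of_bool (i = j)"
      by blast
    have "card S < CARD('n)"
      using 2 by (metis UNIV_I finite psubsetI psubset_card_mono subset_UNIV)
    then obtain w r where
      w: "norm w = 1" "A *v w = r *\<^sub>R w" "\<And>j. j \<in> S \<Longrightarrow> cinner (v j) w = 0"
      using hermitian_eigenvector_exists [of A S v d] A v by metis
    then have w': "cinner w (v j) = 0" if "j \<in> S" for j
      using that by (simp add: cinner_commute [of w])
    have "cinner w w = 1"
      using w(1) by (simp add: cinner_self)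
    have ne: "i \<noteq> k" if "i \<in> S" for i
      using that 2 by blast
    show ?case
      by (rule exI [of _ "v(k := w)"], rule exI [of _ "d(k := r)"])
        (use w w' v on ne ne [symmetric] \<open>cinner w w = 1\<close> in \<open>auto\<close>)
  qed
  from this [of UNIV] obtain v :: "'n \<Rightarrow> complex^'n" and d where
    v: "\<And>i. A *v v i = d i *\<^sub>R v i" and on: "\<And>i j. cinner (v i) (v j) = of_bool (i = j)"
    by blast
  define V where "V = (\<chi> i j. v j $ i)"
  have VV: "dagger V ** V = mat 1"
    using on by (auto simp add: vec_eq_iff V_def matrix_matrix_mult_def mat_def cinner_def)
  then have VV': "V ** dagger V = mat 1"
    by (rule matrix_left_right_inverse [THEN iffD1])
  have "A ** V = V ** diag_matrix d"
  proof -
    have "(A ** V) $ i $ j = (A *v v j) $ i" for i j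
      by (simp add: matrix_matrix_mult_def matrix_vector_mult_def V_def)
    moreover have "(V ** diag_matrix d) $ i $ j = (d j *\<^sub>R v j) $ i" for i j
      by (simp add: matrix_matrix_mult_def V_def diag_matrix_def scaleR_conv_of_real[where 'a = complex] mult.commute
          if_distrib [where f = "\<lambda>x. _ * x"] cong: if_cong)
    ultimately show ?thesis
      by (simp add: vec_eq_iff v)
  qed
  then have "A = V ** diag_matrix d ** dagger V"
    by (metis VV' matrix_mul_assoc matrix_mul_rid)
  with VV VV' that show ?thesis by blast
qed

text \<open>\<open>psd_sqrt\<close> is a definite description, so uniqueness of the positive root is
  required. On an eigenvector \<open>v\<close> of \<open>R ** R\<close> for the square of
  \<open>d k\<close>, the vector \<open>u\<close> obtained by applying \<open>R - d k\<close> is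
  killed by \<open>R + d k\<close>; for \<open>d k > 0\<close> positivity of \<open>R\<close> then
  forces \<open>u = 0\<close>.\<close>

lemma psd_square_root_unique:
  assumes R: "psd R" and d: "\<And>i. 0 \<le> d i"
    and V: "dagger V ** V = mat 1" "V ** dagger V = mat 1"
    and RR: "R ** R = V ** diag_matrix (\<lambda>i. d i * d i) ** dagger V"
  shows "R = V ** diag_matrix d ** dagger V"
proof -
  have col: "R *v column k V = d k *\<^sub>R column k V" for k
  proof -
    define v where "v = column k V"
    define u where "u = R *v v - d k *\<^sub>R v"
    have "R ** R ** V = V ** diag_matrix (\<lambda>i. d i * d i)"
      by (metis RR V(1) matrix_mul_assoc matrix_mul_rid)
    moreover have "(R *v (R *v v)) $ i = (R ** R ** V) $ i $ k" for i
      by (simp add: matrix_vector_mul_assoc v_def)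
        (simp add: matrix_matrix_mult_def matrix_vector_mult_def column_def)
    moreover have "(V ** diag_matrix (\<lambda>i. d i * d i)) $ i $ k = ((d k * d k) *\<^sub>R v) $ i" for i
      by (simp add: matrix_matrix_mult_def v_def column_def diag_matrix_def scaleR_conv_of_real[where 'a = complex] mult_ac
          if_distrib [where f = "\<lambda>x. _ * x"] cong: if_cong)
    ultimately have RRv: "R *v (R *v v) = (d k * d k) *\<^sub>R v"
      by (simp add: vec_eq_iff)
    have Ru: "R *v u = - (d k *\<^sub>R u)"
      by (simp add: u_def matrix_vector_mult_diff_distrib matrix_vector_mult_scaleR RRv algebra_simps)
    have "cinner u u = 0"
    proof (cases "d k = 0")
      \<comment> \<open>For eigenvalue 0 there is no sign contradiction; instead
        \<open>u = R *v v\<close>, and moving \<open>R\<close> across the inner product gives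
        \<open>R *v u = 0\<close>.\<close>
      case True
      then have "u = R *v v" by (simp add: u_def)
      then have "cinner u u = cinner v (R *v u)"
        by (simp add: cinner_hermitian [OF psd_imp_hermitian [OF R]])
      also have "\<dots> = 0"
        using Ru True by (simp add: cinner_def)
      finally show ?thesis .
    next
      case False
      have "cinner u (R *v u) = of_real (- (d k * (norm u)\<^sup>2))"
        using cinner_scaleR_right [of u "- d k" u] by (simp add: Ru cinner_self)
      moreover have "cinner u (R *v u) \<in> \<real>\<^sub>\<ge>\<^sub>0"
        using R by (simp add: psd_cinner)
      ultimately have "0 \<le> - (d k * (norm u)\<^sup>2)"
        by (simp only: nonneg_Reals_of_real_iff)
      moreover have "0 < d k" using d [of k] False by simp
      ultimately have "norm u = 0"
        by (simp add: mult_le_0_iff)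
      then show ?thesis by simp
    qed
    then show ?thesis
      by (simp add: u_def v_def)
  qed
  have "R ** V = V ** diag_matrix d"
  proof -
    have "(R ** V) $ i $ k = (R *v column k V) $ i" for i k
      by (simp add: matrix_matrix_mult_def matrix_vector_mult_def column_def)
    moreover have "(V ** diag_matrix d) $ i $ k = (d k *\<^sub>R column k V) $ i" for i k
      by (simp add: matrix_matrix_mult_def column_def diag_matrix_def scaleR_conv_of_real[where 'a = complex] mult.commute
          if_distrib [where f = "\<lambda>x. _ * x"] cong: if_cong)
    ultimately show ?thesis
      by (simp add: vec_eq_iff col)
  qed
  then show ?thesis
    by (metis V(2) matrix_mul_assoc matrix_mul_rid)
qed

lemma conj_diag_mult:
  assumes "dagger V ** V = mat 1"
  shows "(V ** diag_matrix d ** dagger V) ** (V ** diag_matrix e ** dagger V) =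
    V ** diag_matrix (\<lambda>i. d i * e i) ** dagger V"
proof -
  have "(V ** diag_matrix d ** dagger V) ** (V ** diag_matrix e ** dagger V) =
      V ** diag_matrix d ** (dagger V ** V) ** diag_matrix e ** dagger V"
    by (simp only: matrix_mul_assoc)
  also have "\<dots> = V ** (diag_matrix d ** diag_matrix e) ** dagger V"
    by (simp only: assms matrix_mul_rid) (simp only: matrix_mul_assoc)
  finally show ?thesis
    by (simp only: diag_mult)
qed

text \<open>Resolves the definite description: the absolute value of a hermitian matrix is taken on
  its eigenvalues.\<close>

lemma psd_sqrt_eq:
  assumes V: "dagger V ** V = mat 1" "V ** dagger V = mat 1"
    and A: "A = V ** diag_matrix d ** dagger V"
  shows "psd_sqrt (dagger A ** A) = V ** diag_matrix (\<lambda>i. \<bar>d i\<bar>) ** dagger V"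
proof -
  have "dagger A = A"
    by (simp add: A dagger_mult matrix_mul_assoc)
  then have AA: "dagger A ** A = V ** diag_matrix (\<lambda>i. \<bar>d i\<bar> * \<bar>d i\<bar>) ** dagger V"
    by (simp add: A conj_diag_mult [OF V(1)] flip: abs_mult)
  show ?thesis
    unfolding psd_sqrt_def AA
  proof (rule the_equality)
    show "psd (V ** diag_matrix (\<lambda>i. \<bar>d i\<bar>) ** dagger V) \<and>
      V ** diag_matrix (\<lambda>i. \<bar>d i\<bar>) ** dagger V ** (V ** diag_matrix (\<lambda>i. \<bar>d i\<bar>) ** dagger V) =
      V ** diag_matrix (\<lambda>i. \<bar>d i\<bar> * \<bar>d i\<bar>) ** dagger V"
      using conj_diag_mult [OF V(1)] by (auto intro!: psd_sandwich psd_diag)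
    fix R
    assume "psd R \<and> R ** R = V ** diag_matrix (\<lambda>i. \<bar>d i\<bar> * \<bar>d i\<bar>) ** dagger V"
    then show "R = V ** diag_matrix (\<lambda>i. \<bar>d i\<bar>) ** dagger V"
      using psd_square_root_unique [OF _ _ V, of R "\<lambda>i. \<bar>d i\<bar>"] by simp
  qed
qed

lemma trace_conj_diag:
  assumes "dagger V ** V = mat 1"
  shows "trace (V ** diag_matrix d ** dagger V) = of_real (\<Sum>i\<in>UNIV. d i)"
proof -
  have "trace (V ** diag_matrix d ** dagger V) = trace (dagger V ** (V ** diag_matrix d))"
    by (rule trace_mul_sym)
  also have "\<dots> = trace (diag_matrix d)"
    by (metis assms matrix_mul_assoc matrix_mul_lid)
  finally show ?thesis
    by (simp add: trace_def diag_matrix_def)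
qed

section \<open>The cone of positive operators and differences of its elements\<close>

lemma psd_diagonal:
  assumes "psd A"
  shows "0 \<le> Re (A $ i $ i)"
  using assms by (metis cinner_axis complex_nonneg_Reals_iff psd_cinner)

lemma psd_add: "psd A \<Longrightarrow> psd B \<Longrightarrow> psd (A + B)"
  by (simp add: psd_cinner matrix_vector_mult_add_rdistrib cinner_add_right)

lemma psd_0 [simp]: "psd 0"
  by (simp add: psd_cinner cinner_def)

lemma psd_sum: "(\<And>x. x \<in> X \<Longrightarrow> psd (A x)) \<Longrightarrow> psd (\<Sum>x\<in>X. A x)"
  by (induction X rule: infinite_finite_induct) (auto simp add: psd_add)

lemma psd_scaleR:
  assumes "0 \<le> c" "psd A"
  shows "psd (c *\<^sub>R A)"
proof -
  have "cinner v ((c *\<^sub>R A) *v v) = of_real c * cinner v (A *v v)" for v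
    by (simp add: cinner_def matrix_vector_mult_def sum_distrib_left scaleR_conv_of_real [where 'a = complex] mult_ac)
  with assms show ?thesis
    by (simp add: psd_cinner)
qed

text \<open>
  For hermitian \<open>A\<close> the least such \<open>r\<close> is the trace norm. In this form the triangle inequality,
  tensoring with a positive operator and applying a positive trace-preserving map need no
  spectral theory.
\<close>

definition jordan_bound :: "'n::finite operator \<Rightarrow> real \<Rightarrow> bool"
  where "jordan_bound A r \<longleftrightarrow>
    (\<exists>P Q. psd P \<and> psd Q \<and> A = P - Q \<and> Re (trace P) + Re (trace Q) \<le> r)"

text \<open>In an eigenbasis of \<open>A\<close> the diagonal entries of \<open>P\<close> and
  \<open>Q\<close> are nonnegative and differ by the eigenvalue \<open>d i\<close>, so they add up
  to at least its absolute value. The positive and negative spectral parts attain equality.\<close>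

lemma jordan_bound_iff_trace_norm:
  assumes "hermitian A"
  shows "jordan_bound A r \<longleftrightarrow> trace_norm A \<le> r"
proof -
  obtain V d where V: "dagger V ** V = mat 1" "V ** dagger V = mat 1"
    and A: "A = V ** diag_matrix d ** dagger V"
    using hermitian_diagonalizable [OF assms] by metis
  have tn: "trace_norm A = (\<Sum>i\<in>UNIV. \<bar>d i\<bar>)"
    by (simp add: trace_norm_def psd_sqrt_eq [OF V A] trace_conj_diag [OF V(1)])
  show ?thesis
  proof
    assume "jordan_bound A r"
    then obtain P Q where PQ: "psd P" "psd Q" "A = P - Q" "Re (trace P) + Re (trace Q) \<le> r"
      by (auto simp add: jordan_bound_def)
    define P' Q' where "P' = dagger V ** P ** V" and "Q' = dagger V ** Q ** V"
    have psd': "psd P'" "psd Q'"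
      using psd_sandwich [of _ "dagger V"] PQ by (simp_all add: P'_def Q'_def)
    have "diag_matrix d = dagger V ** A ** V"
      using V(1) unfolding A by (metis matrix_mul_assoc matrix_mul_lid matrix_mul_rid)
    also have "\<dots> = P' - Q'"
      by (simp add: PQ P'_def Q'_def matrix_matrix_mult_def vec_eq_iff algebra_simps sum_subtractf)
    finally have "diag_matrix d $ i $ i = P' $ i $ i - Q' $ i $ i" for i
      by simp
    then have "Re (of_real (d i)) = Re (P' $ i $ i) - Re (Q' $ i $ i)" for i
      by (simp add: diag_matrix_def)
    then have "\<bar>d i\<bar> \<le> Re (P' $ i $ i) + Re (Q' $ i $ i)" for i
      using psd' [THEN psd_diagonal, of i] by simp
    then have "(\<Sum>i\<in>UNIV. \<bar>d i\<bar>) \<le> Re (trace P') + Re (trace Q')"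
      by (simp add: trace_def sum_mono flip: sum.distrib)
    moreover have "trace (dagger V ** M ** V) = trace M" for M
      by (metis V(2) matrix_mul_assoc matrix_mul_rid trace_mul_sym)
    ultimately show "trace_norm A \<le> r"
      using PQ(4) by (simp add: tn P'_def Q'_def)
  next
    assume r: "trace_norm A \<le> r"
    define pm where "pm e = V ** diag_matrix e ** dagger V" for e
    have "A = pm (\<lambda>i. max (d i) 0) - pm (\<lambda>i. max (- d i) 0)"
    proof -
      have "diag_matrix d = diag_matrix (\<lambda>i. max (d i) 0) - diag_matrix (\<lambda>i. max (- d i) 0)"
        by (auto simp add: vec_eq_iff diag_matrix_def max_def)
      then show ?thesis
        unfolding A pm_def
        by (subst \<open>diag_matrix d = _\<close>) (simp add: matrix_matrix_mult_def vec_eq_iff algebra_simps sum_subtractf)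
    qed
    moreover have "psd (pm e)" if "\<And>i. 0 \<le> e i" for e
      unfolding pm_def by (intro psd_sandwich psd_diag that)
    moreover have "Re (trace (pm (\<lambda>i. max (d i) 0))) + Re (trace (pm (\<lambda>i. max (- d i) 0))) = (\<Sum>i\<in>UNIV. \<bar>d i\<bar>)"
      unfolding pm_def trace_conj_diag [OF V(1)] Re_complex_of_real sum.distrib [symmetric]
      by (intro sum.cong) auto
    ultimately show "jordan_bound A r"
      unfolding jordan_bound_def using r tn by (metis max.cobounded2 order.refl)
  qed
qed

section \<open>The classical leftover hash lemma\<close>

lemma sum_UNIV_prod: "(\<Sum>p\<in>UNIV. g (fst p) (snd p)) = (\<Sum>x\<in>UNIV. \<Sum>y\<in>UNIV. g x y)"
  by (simp add: sum.cartesian_product case_prod_unfold flip: UNIV_Times_UNIV)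

lemma sum_square_swap:
  fixes h :: "'p \<Rightarrow> 'x \<Rightarrow> 'a::comm_semiring_1"
  shows "(\<Sum>p\<in>P. (\<Sum>x\<in>X. h p x)\<^sup>2) = (\<Sum>x\<in>X. \<Sum>x'\<in>X. \<Sum>p\<in>P. h p x * h p x')"
proof -
  have "(\<Sum>p\<in>P. (\<Sum>x\<in>X. h p x)\<^sup>2) = (\<Sum>p\<in>P. \<Sum>x\<in>X. \<Sum>x'\<in>X. h p x * h p x')"
    by (simp add: power2_eq_square sum_product)
  also have "\<dots> = (\<Sum>x\<in>X. \<Sum>p\<in>P. \<Sum>x'\<in>X. h p x * h p x')"
    by (rule sum.swap)
  also have "\<dots> = (\<Sum>x\<in>X. \<Sum>x'\<in>X. \<Sum>p\<in>P. h p x * h p x')"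
    by (intro sum.cong refl sum.swap)
  finally show ?thesis .
qed

text \<open>Cauchy-Schwarz over all triples of seed, output and leaked value reduces the sum of
  absolute values to a second moment. Expanding the square gives a sum over pairs of inputs, where
  only equal inputs can contribute positively.\<close>

lemma leftover_hash:
  fixes f :: "'s::finite \<Rightarrow> 'x::finite \<Rightarrow> 'z::finite" and l :: "'x \<Rightarrow> 'l::finite"
  assumes "\<And>x x'. x \<noteq> x' \<Longrightarrow> real (card {s. f s x = f s x'}) \<le> real CARD('s) / real CARD('z)"
  shows "(\<Sum>s\<in>UNIV. \<Sum>z\<in>UNIV. \<Sum>e\<in>UNIV. \<bar>\<Sum>x\<in>UNIV. (of_bool (f s x = z) - 1 / real CARD('z)) * of_bool (l x = e)\<bar>)
    \<le> real CARD('s) * sqrt (real CARD('z) * real CARD('l) * real CARD('x))"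
proof -
  define Z where "Z = real CARD('z)"
  have "Z > 0" by (simp add: Z_def)
  define g where "g s z x = of_bool (f s x = z) - 1 / Z" for s z x
  define b where "b s z e = (\<Sum>x\<in>UNIV. g s z x * of_bool (l x = e))" for s z e
  \<comment> \<open>Summing over \<open>z\<close> turns a product of centred indicators into the
    collision indicator minus the ideal collision probability \<open>1 / Z\<close>. This centring is
    what makes the off-diagonal pairs nonpositive below.\<close>
  have gg: "(\<Sum>z\<in>UNIV. g s z x * g s z x') = of_bool (f s x = f s x') - 1 / Z" for s x x'
  proof -
    have "g s z x * g s z x' =
        of_bool (z = f s x) * of_bool (f s x = f s x') - of_bool (z = f s x) / Z - of_bool (z = f s x') / Z + 1 / Z\<^sup>2" for z
      by (auto simp add: g_def algebra_simps power2_eq_square)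
    then have "(\<Sum>z\<in>UNIV. g s z x * g s z x') = of_bool (f s x = f s x') - 1 / Z - 1 / Z + Z * (1 / Z\<^sup>2)"
      by (simp add: sum.distrib sum_subtractf Z_def of_bool_def flip: sum_divide_distrib sum_distrib_right)
    then show ?thesis
      using \<open>Z > 0\<close> by (simp add: power2_eq_square)
  qed
  have ll: "(\<Sum>e\<in>UNIV. of_bool (l x = e) * of_bool (l x' = e)) = (of_bool (l x = l x') :: real)" for x x'
    by (simp add: of_bool_def if_distrib [where f = "\<lambda>x. x * _"] cong: if_cong)
  define B where "B p = b (fst p) (fst (snd p)) (snd (snd p))" for p
  have triple: "(\<Sum>p\<in>UNIV. h (fst p) (fst (snd p)) (snd (snd p))) = (\<Sum>s\<in>UNIV. \<Sum>z\<in>UNIV. \<Sum>e\<in>UNIV. h s z e)"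
    for h :: "'s \<Rightarrow> 'z \<Rightarrow> 'l \<Rightarrow> real"
    using sum_UNIV_prod [of "\<lambda>s q. h s (fst q) (snd q)"] by (simp add: sum_UNIV_prod)
  have "(\<Sum>p\<in>UNIV. (B p)\<^sup>2) = (\<Sum>x\<in>UNIV. \<Sum>x'\<in>UNIV. \<Sum>p\<in>UNIV.
      (g (fst p) (fst (snd p)) x * of_bool (l x = snd (snd p))) *
      (g (fst p) (fst (snd p)) x' * of_bool (l x' = snd (snd p))))"
    unfolding B_def b_def by (rule sum_square_swap)
  also have "\<dots> = (\<Sum>x\<in>UNIV. \<Sum>x'\<in>UNIV. \<Sum>s\<in>UNIV. \<Sum>z\<in>UNIV. \<Sum>e\<in>UNIV.
      (g s z x * g s z x') * (of_bool (l x = e) * of_bool (l x' = e)))"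
    by (intro sum.cong refl triple [THEN trans]) (simp only: mult_ac)
  also have "\<dots> = (\<Sum>x\<in>UNIV. \<Sum>x'\<in>UNIV. (real (card {s. f s x = f s x'}) - real CARD('s) / Z) * of_bool (l x = l x'))"
    by (simp add: ll gg sum_subtractf flip: sum_distrib_left sum_distrib_right)
  \<comment> \<open>Distinct inputs contribute at most 0 by the collision bound, equal ones at most
    the number of seeds.\<close>
  also have "\<dots> \<le> (\<Sum>x\<in>(UNIV :: 'x set). \<Sum>x'\<in>UNIV. if x = x' then real CARD('s) else (0 :: real))"
  proof (intro sum_mono)
    fix x x' :: 'x
    show "(real (card {s. f s x = f s x'}) - real CARD('s) / Z) * of_bool (l x = l x') \<le>
        (if x = x' then real CARD('s) else (0 :: real))"
      using assms [of x x'] \<open>Z > 0\<close> by (auto simp add: Z_def)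
  qed
  also have "\<dots> = real CARD('x) * real CARD('s)"
    by simp
  finally have b2: "(\<Sum>p\<in>UNIV. (B p)\<^sup>2) \<le> real CARD('x) * real CARD('s)" .
  have "(\<Sum>s\<in>UNIV. \<Sum>z\<in>UNIV. \<Sum>e\<in>UNIV. \<bar>b s z e\<bar>) = (\<Sum>p\<in>UNIV. \<bar>B p\<bar> * 1)"
    using triple [of "\<lambda>s z e. \<bar>b s z e\<bar>"] by (simp add: B_def)
  \<comment> \<open>Cauchy-Schwarz against the constant 1, whose squared norm counts the
    triples.\<close>
  also have "\<dots> \<le> sqrt ((\<Sum>p\<in>UNIV. \<bar>B p\<bar>\<^sup>2) * (\<Sum>p\<in>(UNIV :: ('s \<times> 'z \<times> 'l) set). 1\<^sup>2))"
    by (rule real_le_rsqrt [OF Cauchy_Schwarz_ineq_sum])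
  also have "\<dots> \<le> sqrt (real CARD('x) * real CARD('s) * (real CARD('s) * real CARD('z) * real CARD('l)))"
    using b2 by (intro real_sqrt_le_mono mult_mono) auto
  also have "\<dots> = sqrt ((real CARD('s))\<^sup>2 * (real CARD('z) * real CARD('l) * real CARD('x)))"
    by (simp add: power2_eq_square mult_ac)
  also have "\<dots> = real CARD('s) * sqrt (real CARD('z) * real CARD('l) * real CARD('x))"
    by (simp add: real_sqrt_mult)
  finally show ?thesis
    by (simp add: b_def g_def Z_def)
qed

section \<open>Counting and concatenating bitstrings\<close>

lemma card_bitstring: "CARD('n::len0 bitstring) = 2 ^ LENGTH('n)"
proof -
  have "CARD('n bitstring) = card {xs :: bool list. length xs = LENGTH('n)}"
    using type_definition.card [OF type_definition_bitstring] .
  then show ?thesis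
    using card_lists_length_eq [of "UNIV :: bool set" "LENGTH('n)"] by simp
qed

text \<open>The fixed lengths determine where to split, which gives injectivity; surjectivity then
  follows by counting.\<close>

lemma bij_bits_append:
  "bij (\<lambda>p :: 'n::len0 bitstring \<times> 'm::len0 bitstring. fst p \<circ>\<^sub>b snd p)"
proof -
  have "inj (\<lambda>p :: 'n bitstring \<times> 'm bitstring. fst p \<circ>\<^sub>b snd p)"
  proof (rule injI)
    fix p q :: "'n bitstring \<times> 'm bitstring"
    assume eq: "fst p \<circ>\<^sub>b snd p = fst q \<circ>\<^sub>b snd q"
    have len: "length (list_of_bits x) = LENGTH('k)" for x :: "'k::len0 bitstring"
      using list_of_bits [of x] by simp
    have "list_of_bits (x \<circ>\<^sub>b y) = list_of_bits x @ list_of_bits y"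
      for x :: "'n bitstring" and y :: "'m bitstring"
      unfolding bits_append_def by (rule bits_of_list_inverse) (simp add: len len_sum)
    with eq have "list_of_bits (fst p) @ list_of_bits (snd p) = list_of_bits (fst q) @ list_of_bits (snd q)"
      by metis
    then show "p = q"
      by (simp add: len list_of_bits_inject prod_eq_iff)
  qed
  moreover from this have "surj (\<lambda>p :: 'n bitstring \<times> 'm bitstring. fst p \<circ>\<^sub>b snd p)"
    by (intro card_subset_eq) (simp_all add: card_image card_bitstring len_sum power_add)
  ultimately show ?thesis
    by (simp add: bij_def)
qed

lemma sum_bits_append:
  fixes g :: "('n::len0 + 'm::len0) bitstring \<Rightarrow> 'a::comm_monoid_add"
  shows "(\<Sum>x\<in>UNIV. \<Sum>y\<in>UNIV. g (x \<circ>\<^sub>b y)) = (\<Sum>x\<in>UNIV. g x)"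
proof -
  have "(\<Sum>x\<in>UNIV. \<Sum>y\<in>UNIV. g (x \<circ>\<^sub>b y)) =
      (\<Sum>p\<in>(UNIV :: ('n bitstring \<times> 'm bitstring) set). g (fst p \<circ>\<^sub>b snd p))"
    by (simp add: sum.cartesian_product case_prod_unfold flip: UNIV_Times_UNIV)
  also have "\<dots> = (\<Sum>x\<in>UNIV. g x)"
    by (rule sum.reindex_bij_betw [OF bij_bits_append])
  finally show ?thesis .
qed

lemma one_almost_universal2_card:
  fixes f :: "'s::len0 bitstring \<Rightarrow> 'n::len0 bitstring \<Rightarrow> 'z::len0 bitstring"
  assumes "one_almost_universal2 f" "x \<noteq> x'"
  shows "real (card {s. f s x = f s x'}) \<le> real CARD('s bitstring) / real CARD('z bitstring)"
  using assms
  by (simp add: one_almost_universal2_def measure_pmf_of_set card_bitstring [where 'n = 'z] field_simps)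

section \<open>Tensor products and trace distance\<close>

text \<open>Converse of \<open>psd_gram\<close>: the factor is \<open>V\<close> times the square
  root of the diagonal matrix. Positivity of tensor products and of blocks thereby reduces to
  manipulating factors.\<close>

lemma psd_factor:
  fixes A :: "'n::finite operator"
  assumes "psd A"
  shows "\<exists>c :: 'n \<Rightarrow> 'n \<Rightarrow> complex. \<forall>i j. A $ i $ j = (\<Sum>k\<in>UNIV. c i k * cnj (c j k))"
proof -
  obtain V d where V: "dagger V ** V = mat 1" and A: "A = V ** diag_matrix d ** dagger V"
    using hermitian_diagonalizable [OF psd_imp_hermitian [OF assms]] by metis
  have "diag_matrix d = dagger V ** A ** V"
    using V unfolding A by (metis matrix_mul_assoc matrix_mul_lid matrix_mul_rid)
  then have "psd (diag_matrix d)"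
    using psd_sandwich [OF assms, of "dagger V"] by simp
  then have d: "0 \<le> d k" for k
    using psd_diagonal [of "diag_matrix d" k] by (simp add: diag_matrix_def)
  have "A $ i $ j = (\<Sum>k\<in>UNIV. (V $ i $ k * of_real (sqrt (d k))) * cnj (V $ j $ k * of_real (sqrt (d k))))" for i j
  proof -
    have "A $ i $ j = (\<Sum>k\<in>UNIV. V $ i $ k * of_real (d k) * cnj (V $ j $ k))"
      by (simp add: A matrix_matrix_mult_def diag_matrix_def if_distrib [where f = "\<lambda>x. _ * x"] cong: if_cong)
    moreover have "of_real (d k) = of_real (sqrt (d k)) * (of_real (sqrt (d k)) :: complex)" for k
      using d [of k] by (simp flip: of_real_mult)
    ultimately show ?thesis
      by (simp add: mult_ac)
  qed
  then show ?thesis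
    by (intro exI [of _ "\<lambda>i k. V $ i $ k * of_real (sqrt (d k))"] allI)
qed

lemma psd_tensor:
  fixes A :: "'a::finite operator" and B :: "'b::finite operator"
  assumes "psd A" "psd B"
  shows "psd (A \<otimes> B)"
proof -
  obtain a :: "'a \<Rightarrow> 'a \<Rightarrow> complex" where a: "\<And>i j. A $ i $ j = (\<Sum>k\<in>UNIV. a i k * cnj (a j k))"
    using psd_factor [OF assms(1)] by blast
  obtain b :: "'b \<Rightarrow> 'b \<Rightarrow> complex" where b: "\<And>i j. B $ i $ j = (\<Sum>k\<in>UNIV. b i k * cnj (b j k))"
    using psd_factor [OF assms(2)] by blast
  show ?thesis
  proof (rule psd_gram)
    fix i j
    show "(A \<otimes> B) $ i $ j =
        (\<Sum>k\<in>UNIV. (a (fst i) (fst k) * b (snd i) (snd k)) * cnj (a (fst j) (fst k) * b (snd j) (snd k)))"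
      by (subst sum_UNIV_prod [where g = "\<lambda>k k'. (a (fst i) k * b (snd i) k') * cnj (a (fst j) k * b (snd j) k')"])
        (simp add: tensor_def a b sum_product mult_ac)
  qed
qed

text \<open>A factor of \<open>A\<close> pulled back along \<open>g\<close> is a factor of the new
  matrix. With \<open>g\<close> the inclusion of a block, this covers partial traces and conditional
  states.\<close>

lemma psd_reindex:
  fixes A :: "'a::finite operator" and g :: "'b::finite \<Rightarrow> 'a"
  assumes "psd A"
  shows "psd (\<chi> i j. A $ g i $ g j)"
proof -
  obtain a :: "'a \<Rightarrow> 'a \<Rightarrow> complex" where "\<And>i j. A $ i $ j = (\<Sum>k\<in>UNIV. a i k * cnj (a j k))"
    using psd_factor [OF assms] by blast
  then show ?thesis
    by (intro psd_gram [where c = "\<lambda>i. a (g i)"]) simp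
qed

section \<open>Algebra of tensor products, traces and projectors\<close>

lemma trace_tensor: "trace (A \<otimes> B) = trace A * trace B"
  by (simp add: trace_def tensor_def sum_UNIV_prod [where g = "\<lambda>x y. A $ x $ x * B $ y $ y"] sum_product)

lemma tensor_add_left: "(A + B) \<otimes> M = A \<otimes> M + B \<otimes> M"
  and tensor_add_right: "M \<otimes> (A + B) = M \<otimes> A + M \<otimes> B"
  and tensor_diff_left: "(A - B) \<otimes> M = A \<otimes> M - B \<otimes> M"
  and tensor_diff_right: "M \<otimes> (A - B) = M \<otimes> A - M \<otimes> B"
  and tensor_scaleR_left: "(r *\<^sub>R A) \<otimes> M = r *\<^sub>R (A \<otimes> M)"
  and tensor_scaleR_right: "M \<otimes> (r *\<^sub>R A) = r *\<^sub>R (M \<otimes> A)"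
  by (simp_all add: tensor_def vec_eq_iff algebra_simps)

lemma tensor_0_left: "0 \<otimes> M = 0"
  and tensor_0_right: "M \<otimes> 0 = 0"
  by (simp_all add: tensor_def vec_eq_iff)

lemma tensor_sum_left: "(\<Sum>x\<in>X. A x) \<otimes> M = (\<Sum>x\<in>X. A x \<otimes> M)"
  by (induction X rule: infinite_finite_induct) (simp_all add: tensor_add_left tensor_0_left)

lemma tensor_sum_right: "M \<otimes> (\<Sum>x\<in>X. A x) = (\<Sum>x\<in>X. M \<otimes> A x)"
  by (induction X rule: infinite_finite_induct) (simp_all add: tensor_add_right tensor_0_right)

lemma trace_zero [simp]: "trace (0 :: 'n::finite operator) = 0"
  by (simp add: trace_def)

lemma trace_sum:
  fixes A :: "'x \<Rightarrow> 'n::finite operator"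
  shows "trace (\<Sum>x\<in>X. A x) = (\<Sum>x\<in>X. trace (A x))"
  by (induction X rule: infinite_finite_induct) (simp_all add: trace_add)

lemma trace_scaleR: "trace (r *\<^sub>R A) = r *\<^sub>R trace (A :: 'n::finite operator)"
  by (simp add: trace_def scaleR_sum_right)

lemma psd_trace:
  assumes "psd A"
  shows "Im (trace A) = 0" "0 \<le> Re (trace A)"
proof -
  have "Im (A $ i $ i) = 0" for i
    using hermitian_nth [OF psd_imp_hermitian [OF assms], of i i] by (simp add: complex_eq_iff)
  then show "Im (trace A) = 0"
    by (simp add: trace_def)
  show "0 \<le> Re (trace A)"
    using psd_diagonal [OF assms] by (simp add: trace_def sum_nonneg)
qed

lemma psd_proj: "psd (proj x)"
  by (rule psd_gram [where c = "\<lambda>i k. of_bool (i = x \<and> k = x)"])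
    (auto simp add: proj_def of_bool_def if_distrib [where f = cnj] if_distrib [where f = "\<lambda>y. y * _"] cong: if_cong)

lemma trace_proj [simp]: "trace (proj x) = 1"
  by (simp add: proj_def trace_def)

definition maximally_mixed :: "'a::finite operator"
  where "maximally_mixed = mat (1 / of_nat CARD('a))"

text \<open>As a uniform mixture of basis projectors, the ideal state has positivity and trace
  termwise, and its tensor products expand into sums over classical values.\<close>

lemma maximally_mixed_eq_sum: "(maximally_mixed :: 'a::finite operator) = (\<Sum>x\<in>UNIV. (1 / real CARD('a)) *\<^sub>R proj x)"
proof -
  have "(\<Sum>x\<in>UNIV. (1 / real CARD('a)) *\<^sub>R proj x) $ i $ j = (maximally_mixed :: 'a operator) $ i $ j" for i j
  proof -
    have "((1 / real CARD('a)) *\<^sub>R proj x) $ i $ j = (if x = i then maximally_mixed $ i $ j else 0)" for x :: 'a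
      by (auto simp add: maximally_mixed_def proj_def mat_def scaleR_conv_of_real [where 'a = complex])
    then show ?thesis
      by (simp add: sum_component)
  qed
  then show ?thesis
    by (simp add: vec_eq_iff)
qed

lemma psd_maximally_mixed: "psd maximally_mixed"
  unfolding maximally_mixed_eq_sum by (intro psd_sum psd_scaleR psd_proj) simp

lemma trace_maximally_mixed [simp]: "trace maximally_mixed = 1"
  by (simp add: maximally_mixed_eq_sum trace_sum trace_scaleR scaleR_conv_of_real [where 'a = complex])

lemma trace_partial_trace_fst: "trace (partial_trace_fst \<rho>) = trace \<rho>"
proof -
  have "trace \<rho> = (\<Sum>a\<in>UNIV. \<Sum>b\<in>UNIV. \<rho> $ (a, b) $ (a, b))"
    using sum_UNIV_prod [of "\<lambda>a b. \<rho> $ (a, b) $ (a, b)"] by (simp add: trace_def)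
  also have "\<dots> = (\<Sum>b\<in>UNIV. \<Sum>a\<in>UNIV. \<rho> $ (a, b) $ (a, b))"
    by (rule sum.swap)
  finally show ?thesis
    by (simp add: trace_def partial_trace_fst_def)
qed

text \<open>A sum of diagonal blocks; it supplies an admissible \<sigma> in
  \<open>dist_uniform\<close>.\<close>

lemma psd_partial_trace_fst:
  assumes "psd \<rho>"
  shows "psd (partial_trace_fst \<rho>)"
proof -
  have "partial_trace_fst \<rho> = (\<Sum>a\<in>UNIV. \<chi> b b'. \<rho> $ (a, b) $ (a, b'))"
    by (simp add: partial_trace_fst_def vec_eq_iff sum_component)
  then show ?thesis
    using psd_reindex [OF assms] by (auto intro!: psd_sum)
qed

section \<open>Rules for decompositions into differences of positive operators\<close>

lemma jordan_bound_mono: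
  assumes "jordan_bound A r" "r \<le> s"
  shows "jordan_bound A s"
proof -
  obtain P Q where "psd P" "psd Q" "A = P - Q" "Re (trace P) + Re (trace Q) \<le> r"
    using assms(1) by (auto simp add: jordan_bound_def)
  then show ?thesis
    unfolding jordan_bound_def using assms(2) by (intro exI [of _ P] exI [of _ Q]) simp
qed

lemma jordan_bound_nonneg:
  assumes "jordan_bound A r"
  shows "0 \<le> r"
proof -
  obtain P Q where "psd P" "psd Q" "A = P - Q" "Re (trace P) + Re (trace Q) \<le> r"
    using assms by (auto simp add: jordan_bound_def)
  then show ?thesis
    using psd_trace(2) [of P] psd_trace(2) [of Q] by linarith
qed

lemma jordan_bound_add:
  assumes "jordan_bound A r" "jordan_bound B s"
  shows "jordan_bound (A + B) (r + s)"
proof -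
  obtain P Q P' Q' where "psd P" "psd Q" "A = P - Q" "Re (trace P) + Re (trace Q) \<le> r"
    "psd P'" "psd Q'" "B = P' - Q'" "Re (trace P') + Re (trace Q') \<le> s"
    using assms by (auto simp add: jordan_bound_def)
  then show ?thesis
    unfolding jordan_bound_def
    by (intro exI [of _ "P + P'"] exI [of _ "Q + Q'"]) (simp add: psd_add trace_add)
qed

lemma jordan_bound_sum:
  assumes "finite X" "\<And>x. x \<in> X \<Longrightarrow> jordan_bound (A x) (r x)"
  shows "jordan_bound (\<Sum>x\<in>X. A x) (\<Sum>x\<in>X. r x)"
  using assms
proof (induction X)
  case empty
  have "jordan_bound (0 - 0) 0"
    unfolding jordan_bound_def by (intro exI [of _ 0]) simp
  then show ?case by simp
qed (simp add: jordan_bound_add)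

lemma jordan_bound_scaleR_psd:
  assumes "psd A"
  shows "jordan_bound (c *\<^sub>R A) (\<bar>c\<bar> * Re (trace A))"
  unfolding jordan_bound_def
proof (intro exI conjI)
  show "psd (max c 0 *\<^sub>R A)" "psd (max (- c) 0 *\<^sub>R A)"
    using assms by (simp_all add: psd_scaleR)
  show "c *\<^sub>R A = max c 0 *\<^sub>R A - max (- c) 0 *\<^sub>R A"
    by (simp add: max_def flip: scaleR_left_diff_distrib)
  show "Re (trace (max c 0 *\<^sub>R A)) + Re (trace (max (- c) 0 *\<^sub>R A)) \<le> \<bar>c\<bar> * Re (trace A)"
    by (simp add: trace_scaleR max_def)
qed

text \<open>Data processing: \<open>F\<close> is applied to both parts of a decomposition. It serves
  for appending a system and for the extraction map.\<close>

lemma jordan_bound_image: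
  assumes A: "jordan_bound A r"
    and diff: "\<And>P Q. F (P - Q) = F P - F Q"
    and psd: "\<And>P. psd P \<Longrightarrow> psd (F P)"
    and trace: "\<And>P. psd P \<Longrightarrow> Re (trace (F P)) \<le> Re (trace P)"
  shows "jordan_bound (F A) r"
proof -
  obtain P Q where PQ: "psd P" "psd Q" "A = P - Q" "Re (trace P) + Re (trace Q) \<le> r"
    using A by (auto simp add: jordan_bound_def)
  then show ?thesis
    unfolding jordan_bound_def using trace [of P] trace [of Q]
    by (intro exI [of _ "F P"] exI [of _ "F Q"]) (simp add: diff psd)
qed

lemma jordan_bound_tensor:
  assumes "jordan_bound A r" "psd M" "Re (trace M) \<le> 1"
  shows "jordan_bound (A \<otimes> M) r" "jordan_bound (M \<otimes> A) r"
proof -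
  have le: "Re (trace P * trace M) \<le> Re (trace P)" if "psd P" for P :: "'c::finite operator"
    using psd_trace [OF that] psd_trace [OF assms(2)] assms(3) by (simp add: mult_left_le)
  show "jordan_bound (A \<otimes> M) r"
    using assms(1)
    by (rule jordan_bound_image [where F = "\<lambda>A. A \<otimes> M"])
      (simp_all only: tensor_diff_left psd_tensor assms(2) trace_tensor le)
  show "jordan_bound (M \<otimes> A) r"
    using assms(1)
    by (rule jordan_bound_image [where F = "\<lambda>A. M \<otimes> A"])
      (simp_all only: tensor_diff_right psd_tensor assms(2) trace_tensor mult.commute [of "trace M"] le)
qed

text \<open>The slack \<delta> stands in for attainment of the minimum: some admissible \<sigma>
  comes strictly below any number above the infimum.\<close>

lemma secureD:
  fixes \<rho> :: "('a::finite \<times> 'b::finite) operator"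
  assumes "secure \<epsilon> \<rho>" "psd \<rho>" "\<delta> > 0"
  obtains \<sigma> where "psd \<sigma>" "trace \<sigma> = trace \<rho>" "jordan_bound (\<rho> - maximally_mixed \<otimes> \<sigma>) (2 * (\<epsilon> + \<delta>))"
proof -
  let ?D = "{1 / 2 * trace_norm (\<rho> - mat (1 / of_nat CARD('a)) \<otimes> \<sigma>) | \<sigma> :: 'b operator.
          psd \<sigma> \<and> trace \<sigma> = trace (partial_trace_fst \<rho>)}"
  \<comment> \<open>The partial trace of \<rho> is admissible; the infimum of an empty set of reals
    would carry no information.\<close>
  have "?D \<noteq> {}"
    using psd_partial_trace_fst [OF assms(2)] by blast
  moreover have "Inf ?D < \<epsilon> + \<delta>"
    using assms(1,3) by (simp add: secure_def dist_uniform_def)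
  ultimately have "\<exists>d\<in>?D. d < \<epsilon> + \<delta>"
    by (rule cInf_lessD)
  then obtain \<sigma> :: "'b operator" where \<sigma>: "psd \<sigma>" "trace \<sigma> = trace \<rho>"
    "1 / 2 * trace_norm (\<rho> - maximally_mixed \<otimes> \<sigma>) < \<epsilon> + \<delta>"
    unfolding maximally_mixed_def trace_partial_trace_fst by blast
  moreover have "hermitian (\<rho> - maximally_mixed \<otimes> \<sigma>)"
    using assms(2) \<sigma>(1) by (intro hermitian_diff psd_imp_hermitian psd_tensor psd_maximally_mixed)
  ultimately show ?thesis
    using that [of \<sigma>] by (simp add: jordan_bound_iff_trace_norm)
qed

text \<open>Converse of \<open>secureD\<close>; since the bound is available for every positive
  \<delta>, the slack disappears in the infimum.\<close>

lemma secureI: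
  fixes \<rho> :: "('a::finite \<times> 'b::finite) operator"
  assumes \<rho>: "psd \<rho>"
    and approx: "\<And>\<delta>. \<delta> > 0 \<Longrightarrow> \<exists>\<sigma>. psd \<sigma> \<and> trace \<sigma> = trace \<rho> \<and>
      jordan_bound (\<rho> - maximally_mixed \<otimes> \<sigma>) (2 * (\<epsilon> + \<delta>))"
  shows "secure \<epsilon> \<rho>"
proof -
  let ?D = "{1 / 2 * trace_norm (\<rho> - mat (1 / of_nat CARD('a)) \<otimes> \<sigma>) | \<sigma> :: 'b operator.
          psd \<sigma> \<and> trace \<sigma> = trace (partial_trace_fst \<rho>)}"
  have herm: "hermitian (\<rho> - maximally_mixed \<otimes> \<sigma>)" if "psd \<sigma>" for \<sigma> :: "'b operator"
    using that \<rho> by (intro hermitian_diff psd_imp_hermitian psd_tensor psd_maximally_mixed)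
  have "0 \<le> trace_norm (\<rho> - maximally_mixed \<otimes> \<sigma>)" if "psd \<sigma>" for \<sigma> :: "'b operator"
    using jordan_bound_iff_trace_norm [OF herm [OF that]] jordan_bound_nonneg by blast
  then have nonneg: "0 \<le> 1 / 2 * trace_norm (\<rho> - mat (1 / of_nat CARD('a)) \<otimes> \<sigma>)" if "psd \<sigma>" for \<sigma> :: "'b operator"
    using that by (simp add: maximally_mixed_def)
  \<comment> \<open>Needed for the infimum to lie below each member of the set.\<close>
  have bdd: "bdd_below ?D"
    by (rule bdd_belowI [of _ 0]) (use nonneg in blast)
  have "Inf ?D \<le> \<epsilon> + \<delta>" if pos: "\<delta> > 0" for \<delta>
  proof -
    obtain \<sigma> :: "'b operator" where \<sigma>: "psd \<sigma>" "trace \<sigma> = trace \<rho>"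
      "jordan_bound (\<rho> - maximally_mixed \<otimes> \<sigma>) (2 * (\<epsilon> + \<delta>))"
      using approx [OF pos] by blast
    then have "1 / 2 * trace_norm (\<rho> - maximally_mixed \<otimes> \<sigma>) \<le> \<epsilon> + \<delta>"
      by (simp add: jordan_bound_iff_trace_norm [OF herm])
    moreover have "1 / 2 * trace_norm (\<rho> - maximally_mixed \<otimes> \<sigma>) \<in> ?D"
      using \<sigma> by (auto simp add: maximally_mixed_def trace_partial_trace_fst)
    ultimately show ?thesis
      using bdd by (meson cInf_lower order_trans)
  qed
  then show ?thesis
    unfolding secure_def dist_uniform_def by (rule field_le_epsilon)
qed

section \<open>Extraction from ideal keys\<close>

lemma conditional_state_diff:
  "conditional_state (P - Q) s x1 x2 = conditional_state P s x1 x2 - conditional_state Q s x1 x2"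
  by (simp add: conditional_state_def vec_eq_iff split: prod.split)

lemma psd_conditional_state:
  assumes "psd \<omega>"
  shows "psd (conditional_state \<omega> s x1 x2)"
proof -
  have "conditional_state \<omega> s x1 x2 =
      (\<chi> i j. \<omega> $ (case i of (a, b, c) \<Rightarrow> ((s, a), (x1, b), (x2, c))) $ (case j of (a, b, c) \<Rightarrow> ((s, a), (x1, b), (x2, c))))"
    by (simp add: conditional_state_def vec_eq_iff split: prod.split)
  then show ?thesis
    by (simp only: psd_reindex [OF assms])
qed

text \<open>The blocks for all classical values together exhaust the diagonal of \<omega>; the proof
  regroups the index tuples by a bijection. Trace preservation of the extraction map rests on
  this.\<close>

lemma sum_trace_conditional_state:
  fixes \<omega> :: "(('s::finite \<times> 'es::finite) \<times> ('x1::finite \<times> 'e1::finite) \<times> ('x2::finite \<times> 'e2::finite)) operator"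
  shows "(\<Sum>s\<in>UNIV. \<Sum>x1\<in>UNIV. \<Sum>x2\<in>UNIV. trace (conditional_state \<omega> s x1 x2)) = trace \<omega>"
proof -
  let ?h = "\<lambda>s x1 x2 a b c. \<omega> $ ((s, a), (x1, b), (x2, c)) $ ((s, a), (x1, b), (x2, c))"
  have "trace \<omega> = (\<Sum>p\<in>UNIV. case p of ((s, a), (x1, b), (x2, c)) \<Rightarrow> ?h s x1 x2 a b c)"
    by (simp add: trace_def case_prod_unfold)
  also have "\<dots> = (\<Sum>(s, x1, x2, a, b, c)\<in>UNIV. ?h s x1 x2 a b c)"
    by (rule sum.reindex_bij_witness [of _ "\<lambda>(s, x1, x2, a, b, c). ((s, a), (x1, b), (x2, c))"
          "\<lambda>((s, a), (x1, b), (x2, c)). (s, x1, x2, a, b, c)"]) auto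
  also have "\<dots> = (\<Sum>s\<in>UNIV. \<Sum>x1\<in>UNIV. \<Sum>x2\<in>UNIV. \<Sum>a\<in>UNIV. \<Sum>b\<in>UNIV. \<Sum>c\<in>UNIV. ?h s x1 x2 a b c)"
    by (simp add: sum.cartesian_product flip: UNIV_Times_UNIV)
  also have "\<dots> = (\<Sum>s\<in>UNIV. \<Sum>x1\<in>UNIV. \<Sum>x2\<in>UNIV. trace (conditional_state \<omega> s x1 x2))"
  proof (intro sum.cong refl)
    fix s x1 x2
    show "(\<Sum>a\<in>UNIV. \<Sum>b\<in>UNIV. \<Sum>c\<in>UNIV. ?h s x1 x2 a b c) = trace (conditional_state \<omega> s x1 x2)"
      by (simp add: trace_def conditional_state_def sum.cartesian_product case_prod_unfold flip: UNIV_Times_UNIV)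
  qed
  finally show ?thesis ..
qed

lemma output_state_diff: "output_state f l (P - Q) = output_state f l P - output_state f l Q"
  by (simp add: output_state_def conditional_state_diff tensor_diff_left tensor_diff_right sum_subtractf)

lemma psd_output_state: "psd \<omega> \<Longrightarrow> psd (output_state f l \<omega>)"
  unfolding output_state_def by (intro psd_sum psd_tensor psd_proj psd_conditional_state)

lemma trace_output_state: "trace (output_state f l \<omega>) = trace \<omega>"
  by (simp add: output_state_def trace_sum trace_tensor sum_trace_conditional_state)

text \<open>For ideal registers the block is the same for all classical values, so the quantum part
  becomes a common factor.\<close>

lemma conditional_state_maximally_mixed:
  fixes \<sigma>S :: "'es::finite operator" and \<sigma>1 :: "'e1::finite operator" and \<sigma>2 :: "'e2::finite operator"
    and s :: "'s::finite" and x1 :: "'x1::finite" and x2 :: "'x2::finite"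
  shows "conditional_state ((maximally_mixed \<otimes> \<sigma>S) \<otimes> (maximally_mixed \<otimes> \<sigma>1) \<otimes> (maximally_mixed \<otimes> \<sigma>2)) s x1 x2 =
    (1 / (real CARD('s) * (real CARD('x1) * real CARD('x2)))) *\<^sub>R (\<sigma>S \<otimes> \<sigma>1 \<otimes> \<sigma>2)"
  by (simp add: conditional_state_def vec_eq_iff tensor_def maximally_mixed_def mat_def
      scaleR_conv_of_real [where 'a = complex])

text \<open>The common quantum factor leaves a combination of the operators \<open>T z s e\<close>
  whose coefficients are classical deviations from uniformity, and \<open>leftover_hash\<close>
  bounds the sum of their absolute values. The result bounds the trace norm, hence twice the
  distance.\<close>

lemma ideal_output_state:
  fixes f :: "'s::len0 bitstring \<Rightarrow> ('n1::len0 + 'n2::len0) bitstring \<Rightarrow> 'z::len0 bitstring"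
    and l :: "('n1 + 'n2) bitstring \<Rightarrow> 'l::len0 bitstring"
    and \<sigma>S :: "'es::finite operator" and \<sigma>1 :: "'e1::finite operator" and \<sigma>2 :: "'e2::finite operator"
  assumes f: "one_almost_universal2 f"
    and psd: "psd \<sigma>S" "psd \<sigma>1" "psd \<sigma>2"
    and trace: "Re (trace (\<sigma>S \<otimes> \<sigma>1 \<otimes> \<sigma>2)) \<le> 1"
  obtains \<tau> where "psd \<tau>" "trace \<tau> = trace (\<sigma>S \<otimes> \<sigma>1 \<otimes> \<sigma>2)"
    "jordan_bound (output_state f l ((maximally_mixed \<otimes> \<sigma>S) \<otimes> (maximally_mixed \<otimes> \<sigma>1) \<otimes> (maximally_mixed \<otimes> \<sigma>2))
        - maximally_mixed \<otimes> \<tau>)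
      (sqrt (real CARD('z bitstring) * real CARD('l bitstring) / real CARD(('n1 + 'n2) bitstring)))"
proof -
  define \<sigma> where "\<sigma> = \<sigma>S \<otimes> \<sigma>1 \<otimes> \<sigma>2"
  have "psd \<sigma>" using psd by (simp add: \<sigma>_def psd_tensor)
  define S where "S = real CARD('s bitstring)"
  define N where "N = real CARD(('n1 + 'n2) bitstring)"
  define Z where "Z = real CARD('z bitstring)"
  have pos: "S > 0" "N > 0" "Z > 0" by (simp_all add: S_def N_def Z_def)
  have N: "N = real CARD('n1 bitstring) * real CARD('n2 bitstring)"
    by (simp add: N_def card_bitstring len_sum power_add)
  \<comment> \<open>The uniform weight of one seed together with one concatenated key.\<close>
  define k where "k = 1 / (S * N)"
  have "k \<ge> 0" using pos by (simp add: k_def)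
  define T :: "'z bitstring \<Rightarrow> 's bitstring \<Rightarrow> 'l bitstring \<Rightarrow> _" where "T z s e = proj z \<otimes> proj s \<otimes> \<sigma> \<otimes> proj e" for z s e
  \<comment> \<open>The ideal output state without its output register.\<close>
  define \<tau> :: "('s bitstring \<times> ('es \<times> 'e1 \<times> 'e2) \<times> 'l bitstring) operator"
    where "\<tau> = (\<Sum>s\<in>UNIV. \<Sum>x\<in>UNIV. k *\<^sub>R (proj s \<otimes> \<sigma> \<otimes> proj (l x)))"
  define g where "g s z e x = (of_bool (f s x = z) - 1 / Z) * of_bool (l x = e)" for s z e x
  have out: "output_state f l ((maximally_mixed \<otimes> \<sigma>S) \<otimes> (maximally_mixed \<otimes> \<sigma>1) \<otimes> (maximally_mixed \<otimes> \<sigma>2)) =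
      (\<Sum>s\<in>UNIV. \<Sum>x\<in>UNIV. k *\<^sub>R T (f s x) s (l x))"
  proof -
    have "(\<Sum>x\<in>UNIV. k *\<^sub>R T (f s x) s (l x)) =
        (\<Sum>x1\<in>UNIV. \<Sum>x2\<in>UNIV. k *\<^sub>R T (f s (x1 \<circ>\<^sub>b x2)) s (l (x1 \<circ>\<^sub>b x2)))" for s
      by (rule sum_bits_append [symmetric])
    then show ?thesis
      by (simp add: output_state_def conditional_state_maximally_mixed T_def
          tensor_scaleR_left tensor_scaleR_right k_def S_def N flip: \<sigma>_def)
  qed
  have mix: "maximally_mixed \<otimes> \<tau> = (\<Sum>s\<in>UNIV. \<Sum>x\<in>UNIV. \<Sum>z\<in>UNIV. (k / Z) *\<^sub>R T z s (l x))"
    by (simp add: maximally_mixed_eq_sum \<tau>_def tensor_sum_left tensor_sum_right tensor_scaleR_left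
        tensor_scaleR_right scaleR_sum_right T_def Z_def)
  have pick: "(\<Sum>z\<in>UNIV. of_bool (a = z) *\<^sub>R h z) = h a" for a :: "'i::finite" and h :: "'i \<Rightarrow> 'v::real_vector"
    by (simp add: of_bool_def if_distrib [where f = "\<lambda>x. x *\<^sub>R _"] cong: if_cong)
  \<comment> \<open>Actual and ideal contributions of one pair \<open>s\<close>, \<open>x\<close>
    are expanded over the same \<open>T z s e\<close>, so that the coefficients can be
    compared.\<close>
  have "k *\<^sub>R T (f s x) s (l x) - (\<Sum>z\<in>UNIV. (k / Z) *\<^sub>R T z s (l x)) = (\<Sum>z\<in>UNIV. \<Sum>e\<in>UNIV. (k * g s z e x) *\<^sub>R T z s e)" for s x
  proof -
    have "(\<Sum>e\<in>UNIV. (k * g s z e x) *\<^sub>R T z s e) = (k * (of_bool (f s x = z) - 1 / Z)) *\<^sub>R T z s (l x)" for z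
      by (simp add: g_def pick mult.assoc flip: scaleR_scaleR scaleR_sum_right)
    also have "\<dots> z = of_bool (f s x = z) *\<^sub>R k *\<^sub>R T z s (l x) - (k / Z) *\<^sub>R T z s (l x)" for z
      by (simp add: algebra_simps)
    finally show ?thesis
      by (simp add: sum_subtractf pick del: scaleR_scaleR)
  qed
  then have "output_state f l ((maximally_mixed \<otimes> \<sigma>S) \<otimes> (maximally_mixed \<otimes> \<sigma>1) \<otimes> (maximally_mixed \<otimes> \<sigma>2)) - maximally_mixed \<otimes> \<tau>
      = (\<Sum>s\<in>UNIV. \<Sum>x\<in>UNIV. \<Sum>z\<in>UNIV. \<Sum>e\<in>UNIV. (k * g s z e x) *\<^sub>R T z s e)"
    by (simp add: out mix flip: sum_subtractf)
  \<comment> \<open>Two swaps bring the sum over \<open>x\<close> inside, so that absolute values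
    are taken only after deviations of different inputs have cancelled.\<close>
  also have "\<dots> = (\<Sum>s\<in>UNIV. \<Sum>z\<in>UNIV. \<Sum>x\<in>UNIV. \<Sum>e\<in>UNIV. (k * g s z e x) *\<^sub>R T z s e)"
    by (intro sum.cong refl sum.swap)
  also have "\<dots> = (\<Sum>s\<in>UNIV. \<Sum>z\<in>UNIV. \<Sum>e\<in>UNIV. \<Sum>x\<in>UNIV. (k * g s z e x) *\<^sub>R T z s e)"
    by (intro sum.cong refl sum.swap)
  also have "\<dots> = (\<Sum>s\<in>UNIV. \<Sum>z\<in>UNIV. \<Sum>e\<in>UNIV. (k * (\<Sum>x\<in>UNIV. g s z e x)) *\<^sub>R T z s e)"
    by (simp add: scaleR_sum_left sum_distrib_left)
  also have "jordan_bound \<dots> (\<Sum>s\<in>UNIV. \<Sum>z\<in>UNIV. \<Sum>e\<in>UNIV. k * \<bar>\<Sum>x\<in>UNIV. g s z e x\<bar>)"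
  proof (intro jordan_bound_sum finite)
    fix s z e
    have "psd (T z s e)"
      unfolding T_def by (intro psd_tensor psd_proj \<open>psd \<sigma>\<close>)
    moreover have "Re (trace (T z s e)) \<le> 1"
      using trace by (simp add: T_def trace_tensor flip: \<sigma>_def)
    ultimately show "jordan_bound ((k * (\<Sum>x\<in>UNIV. g s z e x)) *\<^sub>R T z s e) (k * \<bar>\<Sum>x\<in>UNIV. g s z e x\<bar>)"
      using \<open>k \<ge> 0\<close>
      by (intro jordan_bound_mono [OF jordan_bound_scaleR_psd]) (simp_all add: abs_mult mult_left_le psd_trace)
  qed
  finally have *: "jordan_bound (output_state f l ((maximally_mixed \<otimes> \<sigma>S) \<otimes> (maximally_mixed \<otimes> \<sigma>1) \<otimes> (maximally_mixed \<otimes> \<sigma>2))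
        - maximally_mixed \<otimes> \<tau>) (k * (\<Sum>s\<in>UNIV. \<Sum>z\<in>UNIV. \<Sum>e\<in>UNIV. \<bar>\<Sum>x\<in>UNIV. g s z e x\<bar>))"
    by (simp add: sum_distrib_left)
  have "k * (\<Sum>s\<in>UNIV. \<Sum>z\<in>UNIV. \<Sum>e\<in>UNIV. \<bar>\<Sum>x\<in>UNIV. g s z e x\<bar>) \<le> k * (S * sqrt (Z * real CARD('l bitstring) * N))"
    unfolding g_def S_def N_def Z_def using \<open>k \<ge> 0\<close>
    by (intro mult_left_mono leftover_hash one_almost_universal2_card [OF f])
  \<comment> \<open>\<open>k * S\<close> is \<open>1 / N\<close>, and \<open>N\<close> is written as
    a square root to merge the two roots.\<close>
  also have "\<dots> = sqrt (Z * real CARD('l bitstring) * N) / sqrt (N * N)"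
    using pos by (simp add: k_def)
  also have "\<dots> = sqrt (Z * real CARD('l bitstring) / N)"
    unfolding real_sqrt_divide [symmetric] using pos by simp
  finally have bound: "k * (\<Sum>s\<in>UNIV. \<Sum>z\<in>UNIV. \<Sum>e\<in>UNIV. \<bar>\<Sum>x\<in>UNIV. g s z e x\<bar>) \<le> sqrt (Z * real CARD('l bitstring) / N)" .
  have "psd \<tau>"
    unfolding \<tau>_def using \<open>k \<ge> 0\<close> by (intro psd_sum psd_scaleR psd_tensor psd_proj \<open>psd \<sigma>\<close>)
  moreover have "trace \<tau> = trace \<sigma>"
  proof -
    have "trace \<tau> = (S * N * k) *\<^sub>R trace \<sigma>"
      by (simp add: \<tau>_def trace_sum trace_scaleR trace_tensor S_def N_def scaleR_conv_of_real [where 'a = complex] mult.assoc)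
    then show ?thesis
      using pos by (simp add: k_def)
  qed
  ultimately show ?thesis
    using that [of \<tau>] jordan_bound_mono [OF * bound] by (simp add: Z_def N_def \<sigma>_def)
qed

section \<open>Hybrid argument: from real to ideal seed and keys\<close>

theorem theorem4:
  fixes \<rho>S :: "('s::len0 bitstring \<times> 'es::finite) operator"
    and \<rho>1 :: "('n1::len0 bitstring \<times> 'e1::finite) operator"
    and \<rho>2 :: "('n2::len0 bitstring \<times> 'e2::finite) operator"
    and f :: "'s bitstring \<Rightarrow> ('n1 + 'n2) bitstring \<Rightarrow> 'z::len0 bitstring"
    and l :: "('n1 + 'n2) bitstring \<Rightarrow> 'l::len0 bitstring"
    and \<epsilon>S \<epsilon>1 \<epsilon>2 \<epsilon>' :: real
  assumes "cq_state \<rho>S" and "cq_state \<rho>1" and "cq_state \<rho>2"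
    and "secure \<epsilon>S \<rho>S" and "secure \<epsilon>1 \<rho>1" and "secure \<epsilon>2 \<rho>2"
    and "one_almost_universal2 f"
    and "\<epsilon>' > 0"
    and "real LENGTH('z) \<le> real LENGTH('n1 + 'n2) - real LENGTH('l) - 2 * log 2 (1 / \<epsilon>') + 2"
  shows "secure (\<epsilon>S + \<epsilon>1 + \<epsilon>2 + \<epsilon>') (output_state f l (\<rho>S \<otimes> \<rho>1 \<otimes> \<rho>2))"
proof (rule secureI)
  have psd: "psd \<rho>S" "psd \<rho>1" "psd \<rho>2"
    and trace: "Re (trace \<rho>S) \<le> 1" "Re (trace \<rho>1) \<le> 1" "Re (trace \<rho>2) \<le> 1"
    using assms(1-3) by (simp_all add: cq_state_def state_def)
  then show psd_out: "psd (output_state f l (\<rho>S \<otimes> \<rho>1 \<otimes> \<rho>2))"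
    by (intro psd_output_state psd_tensor)
  have tr_le: "Re (trace (A \<otimes> B)) \<le> 1" if "psd A" "psd B" "Re (trace A) \<le> 1" "Re (trace B) \<le> 1"
    for A :: "'i::finite operator" and B :: "'j::finite operator"
    using that psd_trace [of A] psd_trace [of B] by (simp add: trace_tensor mult_le_one)
  \<comment> \<open>The factor 1/2 in the distance allows a trace norm of
    \<open>2 * \<epsilon>'\<close>; squared, its factor 4 is the \<open>+ 2\<close> in the length
    condition.\<close>
  have length_bound: "sqrt (real CARD('z bitstring) * real CARD('l bitstring) / real CARD(('n1 + 'n2) bitstring)) \<le> 2 * \<epsilon>'"
  proof -
    let ?z = "real LENGTH('z)" and ?l = "real LENGTH('l)" and ?n = "real LENGTH('n1 + 'n2)"
    have "real CARD('z bitstring) * real CARD('l bitstring) / real CARD(('n1 + 'n2) bitstring) = 2 powr (?z + ?l - ?n)"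
      by (simp add: card_bitstring powr_add powr_diff powr_realpow)
    \<comment> \<open>The exponent is split into single summands so that \<open>powr_add\<close>
      yields two factors \<epsilon>' and two factors 2.\<close>
    also have "\<dots> \<le> 2 powr (log 2 \<epsilon>' + log 2 \<epsilon>' + 1 + 1)"
      using assms(8,9) by (intro powr_mono) (simp_all add: log_divide)
    also have "\<dots> = (2 * \<epsilon>')\<^sup>2"
      unfolding powr_add using assms(8) by (simp add: power2_eq_square)
    finally show ?thesis
      using assms(8) by (simp add: real_le_lsqrt)
  qed
  fix \<delta> :: real
  assume "\<delta> > 0"
  \<comment> \<open>The slack is shared among the three approximations of seed and keys.\<close>
  then have \<delta>: "\<delta> / 3 > 0" by simp
  obtain \<sigma>S where S: "psd \<sigma>S" "trace \<sigma>S = trace \<rho>S"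
    "jordan_bound (\<rho>S - maximally_mixed \<otimes> \<sigma>S) (2 * (\<epsilon>S + \<delta> / 3))"
    using secureD [OF assms(4) psd(1) \<delta>] .
  obtain \<sigma>1 where 1: "psd \<sigma>1" "trace \<sigma>1 = trace \<rho>1"
    "jordan_bound (\<rho>1 - maximally_mixed \<otimes> \<sigma>1) (2 * (\<epsilon>1 + \<delta> / 3))"
    using secureD [OF assms(5) psd(2) \<delta>] .
  obtain \<sigma>2 where 2: "psd \<sigma>2" "trace \<sigma>2 = trace \<rho>2"
    "jordan_bound (\<rho>2 - maximally_mixed \<otimes> \<sigma>2) (2 * (\<epsilon>2 + \<delta> / 3))"
    using secureD [OF assms(6) psd(3) \<delta>] .
  define \<tau>S :: "('s bitstring \<times> 'es) operator" where "\<tau>S = maximally_mixed \<otimes> \<sigma>S"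
  define \<tau>1 :: "('n1 bitstring \<times> 'e1) operator" where "\<tau>1 = maximally_mixed \<otimes> \<sigma>1"
  define \<tau>2 :: "('n2 bitstring \<times> 'e2) operator" where "\<tau>2 = maximally_mixed \<otimes> \<sigma>2"
  have \<tau>: "psd \<tau>S" "psd \<tau>1" "Re (trace \<tau>S) \<le> 1" "Re (trace \<tau>1) \<le> 1"
    using S 1 trace by (simp_all add: \<tau>S_def \<tau>1_def psd_tensor psd_maximally_mixed trace_tensor)
  obtain \<tau> where ideal: "psd \<tau>" "trace \<tau> = trace (\<sigma>S \<otimes> \<sigma>1 \<otimes> \<sigma>2)"
    "jordan_bound (output_state f l (\<tau>S \<otimes> \<tau>1 \<otimes> \<tau>2) - maximally_mixed \<otimes> \<tau>)
      (sqrt (real CARD('z bitstring) * real CARD('l bitstring) / real CARD(('n1 + 'n2) bitstring)))"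
    unfolding \<tau>S_def \<tau>1_def \<tau>2_def
    by (rule ideal_output_state [OF assms(7) S(1) 1(1) 2(1), of l])
      (use S 1 2 trace in \<open>auto intro!: tr_le psd_tensor\<close>)
  \<comment> \<open>Telescoping: each of the three differences changes one factor, with ideal
    factors to its left and real ones to its right. The untouched factors are positive of trace at
    most 1, so the bounds survive tensoring.\<close>
  have "jordan_bound ((\<rho>S - \<tau>S) \<otimes> \<rho>1 \<otimes> \<rho>2) (2 * (\<epsilon>S + \<delta> / 3))"
    unfolding \<tau>S_def by (intro jordan_bound_tensor(1) S(3) psd_tensor psd tr_le trace)
  moreover have "jordan_bound (\<tau>S \<otimes> (\<rho>1 - \<tau>1) \<otimes> \<rho>2) (2 * (\<epsilon>1 + \<delta> / 3))"
    by (intro jordan_bound_tensor(2) \<tau> jordan_bound_tensor(1) psd trace) (simp only: \<tau>1_def 1(3))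
  moreover have "jordan_bound (\<tau>S \<otimes> \<tau>1 \<otimes> (\<rho>2 - \<tau>2)) (2 * (\<epsilon>2 + \<delta> / 3))"
    by (intro jordan_bound_tensor(2) \<tau>) (simp only: \<tau>2_def 2(3))
  ultimately have "jordan_bound ((\<rho>S - \<tau>S) \<otimes> \<rho>1 \<otimes> \<rho>2 + (\<tau>S \<otimes> (\<rho>1 - \<tau>1) \<otimes> \<rho>2 + \<tau>S \<otimes> \<tau>1 \<otimes> (\<rho>2 - \<tau>2)))
      (2 * (\<epsilon>S + \<delta> / 3) + (2 * (\<epsilon>1 + \<delta> / 3) + 2 * (\<epsilon>2 + \<delta> / 3)))"
    by (intro jordan_bound_add)
  moreover have "(\<rho>S - \<tau>S) \<otimes> \<rho>1 \<otimes> \<rho>2 + (\<tau>S \<otimes> (\<rho>1 - \<tau>1) \<otimes> \<rho>2 + \<tau>S \<otimes> \<tau>1 \<otimes> (\<rho>2 - \<tau>2)) = \<rho>S \<otimes> \<rho>1 \<otimes> \<rho>2 - \<tau>S \<otimes> \<tau>1 \<otimes> \<tau>2"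
    by (simp add: tensor_diff_left tensor_diff_right)
  moreover have "2 * (\<epsilon>S + \<delta> / 3) + (2 * (\<epsilon>1 + \<delta> / 3) + 2 * (\<epsilon>2 + \<delta> / 3)) = 2 * (\<epsilon>S + \<epsilon>1 + \<epsilon>2 + \<delta>)"
    by simp
  ultimately have "jordan_bound (\<rho>S \<otimes> \<rho>1 \<otimes> \<rho>2 - \<tau>S \<otimes> \<tau>1 \<otimes> \<tau>2) (2 * (\<epsilon>S + \<epsilon>1 + \<epsilon>2 + \<delta>))"
    by (simp only:)
  \<comment> \<open>Extraction is applied once, to the whole difference; as a positive
    trace-preserving map it keeps the bound.\<close>
  then have "jordan_bound (output_state f l (\<rho>S \<otimes> \<rho>1 \<otimes> \<rho>2 - \<tau>S \<otimes> \<tau>1 \<otimes> \<tau>2)) (2 * (\<epsilon>S + \<epsilon>1 + \<epsilon>2 + \<delta>))"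
    by (rule jordan_bound_image) (simp_all add: output_state_diff psd_output_state trace_output_state)
  from jordan_bound_add [OF this jordan_bound_mono [OF ideal(3) length_bound]]
  have "jordan_bound (output_state f l (\<rho>S \<otimes> \<rho>1 \<otimes> \<rho>2) - maximally_mixed \<otimes> \<tau>) (2 * (\<epsilon>S + \<epsilon>1 + \<epsilon>2 + \<epsilon>' + \<delta>))"
    by (simp add: output_state_diff algebra_simps)
  \<comment> \<open>\<tau> has the required trace because each \<sigma> has the trace of the state
    it approximates and extraction preserves trace.\<close>
  with ideal(1,2) S(2) 1(2) 2(2)
  show "\<exists>\<tau>. psd \<tau> \<and> trace \<tau> = trace (output_state f l (\<rho>S \<otimes> \<rho>1 \<otimes> \<rho>2)) \<and>
      jordan_bound (output_state f l (\<rho>S \<otimes> \<rho>1 \<otimes> \<rho>2) - maximally_mixed \<otimes> \<tau>) (2 * (\<epsilon>S + \<epsilon>1 + \<epsilon>2 + \<epsilon>' + \<delta>))"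
    by (intro exI [of _ \<tau>]) (simp add: trace_output_state trace_tensor)
qed

end
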